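(* Let $n\ge 6$ be an even integer. Write $e_1,\dots,e_n$ for the standard basis vectors of $\mathbb{R}^n$, and let $P_n\subset\mathbb{R}^n$ be the convex hull of the following three layers of points: (a) the vertex $V=(\frac12,\dots,\frac12,1)$; (b) the $2^{n-2}$ vertices $(x_1,\dots,x_{n-1},0)$ with $x_i\in\{0,1\}$ and $\sum_{i=1}^{n-1}x_i$ even; (c) the $2(n-1)$ vertices $V_{j,\pm}=(\frac12,\dots,\frac12,-1)\pm e_j$ with $1\le j\le n-1$. Then: (i) $P_n$ is an extreme Delaunay polytope (of the lattice $L_n$ defined in the context); the corresponding quadratic form is $q(x)=x_1^2+\dots+x_{n-1}^2+\frac{n-3}{4}x_n^2$. (ii) The center of the circumscribing sphere of $P_n$ (with respect to $q$) is $(0,\dots,0,\frac{-1}{n-3})$ and its radius is $\frac{n-2}{\sqrt{n-3}}$. (iii) $P_6$ is the Schläfli polytope; its group of isometries has size $51840$ and is transitive on vertices. If $n>6$, then the group of isometries of $P_n$ is $\mathrm{Sym}(n-1)\times 2^{n-2}$ and there are three orbits of vertices.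
   Context: $D_m=\{(x_1,\dots,x_m)\in\mathbb{Z}^m : \sum_{i=1}^m x_i \text{ even}\}$, and $L_n\subset\mathbb{R}^n$ is the lattice generated by all $(x,0)$ with $x\in D_{n-1}$ and by $(\frac12,\dots,\frac12,1)$. For $n$ even, all the points in (a), (b), (c) belong to $L_n$. Let $\mathbb{R}^n$ carry the norm $\|x\|=\sqrt{q(x)}$ for a positive definite quadratic form $q$, and let $L\subset\mathbb{R}^n$ be an $n$-dimensional lattice. A sphere $S=S(c,r)$ with center $c$ and radius $r$ is an empty sphere in $L$ if $\|v-c\|\ge r$ for all $v\in L$ and the set $S\cap L$ has affine rank $n+1$. The convex hull of $S\cap L$ is then called a Delaunay polytope (of $L$, for the form $q$), and $S$ is its circumscribing sphere. A Delaunay polytope $P$ is called extreme if the only (up to isometries) affine bijective transformations $f$ of $\mathbb{R}^n$ for which $f(P)$ is again a Delaunay polytope are the homotheties. The group of isometries of $P_n$ is the group of isometries of $(\mathbb{R}^n,q)$ mapping $P_n$ to itself. $\mathrm{Sym}(n-1)$ is the symmetric group on $n-1$ letters and $2^{n-2}$ denotes the elementary abelian $2$-group of order $2^{n-2}$. The Schläfli polytope is the $6$-dimensional semiregular polytope $2_{21}$ with $27$ vertices, the Delaunay polytope of the root lattice $E_6$.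
   Formalization: The centre is (1/2,…,1/2,-1/(n-3)) and the radius (n-2)/(2√(n-3)): layer (b) is not equidistant from the printed centre, and the printed radius is twice too large. For n>6 the group is the semidirect product of 2^{n-2} by Sym(n-1), not the direct product. *)

theory Defs
  imports
    "HOL-Analysis.Analysis"
    "HOL-Computational_Algebra.Group_Closure"
    "HOL-Algebra.Sym_Groups"
    "HOL-Algebra.Group_Action"
    "HOL-Algebra.Product_Groups"
begin

section \<open>Lattices, Delaunay polytopes, extremality\<close>

definition pos_def_form :: "('a::real_vector \<Rightarrow> real) \<Rightarrow> bool" where
  "pos_def_form q \<longleftrightarrow> (\<exists>B. bilinear B \<and> (\<forall>x. q x = B x x)) \<and> (\<forall>x. x \<noteq> 0 \<longrightarrow> q x > 0)"

definition qnorm :: "('a \<Rightarrow> real) \<Rightarrow> 'a \<Rightarrow> real" where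
  "qnorm q x = sqrt (q x)"

definition full_lattice :: "'a::euclidean_space set \<Rightarrow> bool" where
  "full_lattice L \<longleftrightarrow> (\<exists>B. independent B \<and> span B = UNIV \<and> L = group_closure B)"

definition qsphere :: "('a::real_vector \<Rightarrow> real) \<Rightarrow> 'a \<Rightarrow> real \<Rightarrow> 'a set" where
  "qsphere q c r = {x. qnorm q (x - c) = r}"

text \<open>A set of affine rank \<open>n + 1\<close> (containing \<open>n + 1\<close> affinely independent points) is one of
  affine dimension \<open>n\<close>.\<close>

definition empty_sphere ::
    "('a::euclidean_space \<Rightarrow> real) \<Rightarrow> 'a set \<Rightarrow> 'a \<Rightarrow> real \<Rightarrow> bool" where
  "empty_sphere q L c r \<longleftrightarrow>
     (\<forall>v\<in>L. qnorm q (v - c) \<ge> r) \<and> aff_dim (qsphere q c r \<inter> L) = int DIM('a)"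

definition circumscribing_sphere ::
    "('a::euclidean_space \<Rightarrow> real) \<Rightarrow> 'a set \<Rightarrow> 'a set \<Rightarrow> 'a \<Rightarrow> real \<Rightarrow> bool" where
  "circumscribing_sphere q L P c r \<longleftrightarrow>
     empty_sphere q L c r \<and> P = convex hull (qsphere q c r \<inter> L)"

definition delaunay_polytope ::
    "('a::euclidean_space \<Rightarrow> real) \<Rightarrow> 'a set \<Rightarrow> 'a set \<Rightarrow> bool" where
  "delaunay_polytope q L P \<longleftrightarrow>
     pos_def_form q \<and> full_lattice L \<and> (\<exists>c r. circumscribing_sphere q L P c r)"

definition isometry_between ::
    "('a::real_vector \<Rightarrow> real) \<Rightarrow> ('b::real_vector \<Rightarrow> real) \<Rightarrow> ('a \<Rightarrow> 'b) \<Rightarrow> bool" where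
  "isometry_between q q' f \<longleftrightarrow>
     bij f \<and> (\<forall>x y. qnorm q' (f x - f y) = qnorm q (x - y))"

definition homothety :: "('a::real_vector \<Rightarrow> 'a) \<Rightarrow> bool" where
  "homothety h \<longleftrightarrow> (\<exists>a k. k \<noteq> 0 \<and> h = (\<lambda>x. a + k *\<^sub>R (x - a)))"

definition affine_bijection :: "('a::real_vector \<Rightarrow> 'a) \<Rightarrow> bool" where
  "affine_bijection f \<longleftrightarrow> bij f \<and> (\<exists>A b. linear A \<and> f = (\<lambda>x. A x + b))"

text \<open>The image \<open>f ` P\<close> has to be a Delaunay polytope for the same form \<open>q\<close>, but of an arbitrary
  lattice. Translations are isometries.\<close>

definition extreme_delaunay_polytope ::
    "('a::euclidean_space \<Rightarrow> real) \<Rightarrow> 'a set \<Rightarrow> 'a set \<Rightarrow> bool" where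
  "extreme_delaunay_polytope q L P \<longleftrightarrow>
     delaunay_polytope q L P \<and>
     (\<forall>f. affine_bijection f \<and> (\<exists>L'. delaunay_polytope q L' (f ` P)) \<longrightarrow>
        (\<exists>g h. isometry_between q q g \<and> homothety h \<and> f = g \<circ> h))"

definition polytope_vertices :: "'a::real_vector set \<Rightarrow> 'a set" where
  "polytope_vertices P = {v. v extreme_point_of P}"

definition isometry_group :: "('a::real_vector \<Rightarrow> real) \<Rightarrow> 'a set \<Rightarrow> ('a \<Rightarrow> 'a) monoid" where
  "isometry_group q P =
     \<lparr>carrier = {f. isometry_between q q f \<and> f ` P = P}, monoid.mult = (\<circ>), one = id\<rparr>"


section \<open>The lattices \<open>L\<^sub>n\<close>, the forms and the polytopes \<open>P\<^sub>n\<close>\<close>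

text \<open>The space \<open>\<real>\<^sup>n\<close> is modelled as \<open>\<real>\<^sup>n\<^sup>-\<^sup>1 \<times> \<real>\<close>, i.e. as \<open>(real^'m) \<times> real\<close> with
  \<open>CARD('m) = n - 1\<close>; the second component is the last coordinate.\<close>

definition D_lattice :: "(real^'m) set" where
  "D_lattice = {x. (\<forall>i. x $ i \<in> \<int>) \<and> (\<exists>k::int. (\<Sum>i\<in>UNIV. x $ i) = 2 * of_int k)}"

definition half_vec :: "real^'m" where
  "half_vec = (\<chi> i. 1 / 2)"

definition L_lattice :: "((real^'m) \<times> real) set" where
  "L_lattice = group_closure ({(x, 0) | x. x \<in> D_lattice} \<union> {(half_vec, 1)})"

definition layer_a :: "((real^'m) \<times> real) set" where
  "layer_a = {(half_vec, 1)}"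

definition layer_b :: "((real^'m) \<times> real) set" where
  "layer_b = {(x, 0) | x. (\<forall>i. x $ i \<in> {0, 1}) \<and> (\<exists>k::int. (\<Sum>i\<in>UNIV. x $ i) = 2 * of_int k)}"

definition layer_c :: "((real^'m) \<times> real) set" where
  "layer_c = {(half_vec, - 1) + (axis j 1, 0) | j. True} \<union> {(half_vec, - 1) - (axis j 1, 0) | j. True}"

definition P_polytope :: "((real^'m) \<times> real) set" where
  "P_polytope = convex hull (layer_a \<union> layer_b \<union> layer_c)"

definition P_form :: "nat \<Rightarrow> (real^'m) \<times> real \<Rightarrow> real" where
  "P_form n x = (\<Sum>i\<in>UNIV. (fst x $ i)\<^sup>2) + (real n - 3) / 4 * (snd x)\<^sup>2"


section \<open>The Schlaefli polytope\<close>

text \<open>The polytope \<open>2\<^sub>2\<^sub>1\<close> is obtained by the Wythoff construction: it is the convex hull of the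
  orbit, under the Weyl group of \<open>E\<^sub>6\<close>, of the fundamental weight of the end node of an arm of
  length 2 of the Dynkin diagram. Coordinates on \<open>real^6\<close> are with respect to the simple roots
  (of squared length 2), so that \<open>axis i 1\<close> is the \<open>i\<close>-th simple root. The nodes are labelled
  such that the two arms of length 2 form the chain 1-2-3-4-5, and 6 is attached to 3.\<close>

definition E6_inner :: "real^6 \<Rightarrow> real^6 \<Rightarrow> real" where
  "E6_inner x y = 2 * (\<Sum>i\<in>UNIV. x $ i * y $ i)
     - (\<Sum>(i, j)\<in>{(1, 2), (2, 3), (3, 4), (4, 5), (3, 6)}. x $ i * y $ j + x $ j * y $ i)"

definition E6_form :: "real^6 \<Rightarrow> real" where
  "E6_form x = E6_inner x x"

definition E6_reflection :: "6 \<Rightarrow> real^6 \<Rightarrow> real^6" where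
  "E6_reflection i x = x - E6_inner x (axis i 1) *\<^sub>R axis i 1"

inductive_set E6_orbit :: "(real^6) set \<Rightarrow> (real^6) set" for W where
  base: "w \<in> W \<Longrightarrow> w \<in> E6_orbit W"
| reflect: "x \<in> E6_orbit W \<Longrightarrow> E6_reflection i x \<in> E6_orbit W"

text \<open>The set of starting points is a singleton, because the Gram matrix of \<open>E\<^sub>6\<close> is invertible.\<close>

definition schlafli_polytope :: "(real^6) set" where
  "schlafli_polytope = convex hull
     (E6_orbit {w. \<forall>j. E6_inner w (axis j 1) = (if j = 1 then 1 else 0)})"


section \<open>Groups\<close>

definition elementary_abelian_2_group :: "nat \<Rightarrow> (nat \<Rightarrow> int) monoid" where
  "elementary_abelian_2_group k = product_group {1..k} (\<lambda>_. integer_mod_group 2)"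

definition semidirect_product ::
    "('a, 'c) monoid_scheme \<Rightarrow> ('b, 'd) monoid_scheme \<Rightarrow> ('b \<Rightarrow> 'a \<Rightarrow> 'a) \<Rightarrow> ('a \<times> 'b) monoid" where
  "semidirect_product N H \<phi> =
     \<lparr>carrier = carrier N \<times> carrier H,
      monoid.mult = (\<lambda>(a, s) (b, t). (a \<otimes>\<^bsub>N\<^esub> \<phi> s b, s \<otimes>\<^bsub>H\<^esub> t)),
      one = (\<one>\<^bsub>N\<^esub>, \<one>\<^bsub>H\<^esub>)\<rparr>"

text \<open>The even-weight vectors in the \<open>k\<close>-th power of the group of order two, written as subsets
  of \<open>{1..k}\<close>.\<close>

definition even_subset_group :: "nat \<Rightarrow> nat set monoid" where
  "even_subset_group k =
     \<lparr>carrier = {A. A \<subseteq> {1..k} \<and> even (card A)}, monoid.mult = sym_diff, one = {}\<rparr>"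

end

theory Submission
  imports Defs
begin

text \<open>
  Seen from the center, the form takes a value depending only on the layer and on the distance of the
  first \<open>n - 1\<close> coordinates from \<open>half_vec\<close>; in the layers \<open>0\<close>, \<open>1\<close>, \<open>-1\<close> the lattice
  points closest to \<open>half_vec\<close> are exactly the listed vertices (here \<open>n\<close> even enters: in layer \<open>-1\<close>
  the differences are integer vectors of odd sum, hence nonzero), and the other layers are too far away.
  A quadratic function that vanishes on all vertices is a multiple of the equation of the
  circumscribing sphere. As an affine map \<open>f\<close> with \<open>f ` P\<close> Delaunay pulls the new sphere back to
  such a function, it is an isometry times a homothety.

  An isometry of the polytope permutes the vertices and fixes the center. If it fixes the apex, it acts
  on the first \<open>n - 1\<close> coordinates by a signed permutation of the points of layer \<open>-1\<close>, and layer
  \<open>0\<close> forces the number of sign changes to be even. For \<open>n > 6\<close> the apex is fixed, being the only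
  vertex without another one at squared distance \<open>2\<close>. For \<open>n = 6\<close> the apex has squared norm \<open>2\<close>,
  and the reflection in it mixes the layers, so that the group is transitive of order
  \<open>27 * 1920\<close>; together with reflections in roots of \<open>D\<^sub>5\<close> it generates the Weyl group of \<open>E\<^sub>6\<close>, which
  identifies the vertices with the orbit of a fundamental weight.
\<close>

section \<open>Positive definite forms and spheres\<close>

text \<open>The center in the informal statement is measured from \<open>half_point\<close>: in the
  coordinates of the three layers its first n - 1 entries are 1/2. The apex lies 1 + 1/(n - 3) above
  it along an axis of length sqrt (n - 3) / 2, so the radius is (n - 2) / (2 sqrt (n - 3)), half of
  the informal value. The isometry group for n > 6 is a semidirect product because permuting
  coordinates also permutes the sets of sign changes. The coefficient (n - 3)/4 is the outcome of
  rigidity: layer 0 makes the first n - 1 axes orthogonal, layer -1 gives them a common length and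
  makes them orthogonal to the last axis, and comparing the apex, layer 0 and layer -1 leaves two
  linear equations for the length of the last axis and the height of the center. A polytope enters
  as a convex hull, but every argument needs its vertices. Strict convexity of the norm bridges
  this: each point of a set on a sphere is an extreme point of the hull, so spheres, affine images
  and isometries can all be read off from the vertices.\<close>

locale definite_form =
  fixes q :: "'a::real_vector \<Rightarrow> real" and B :: "'a \<Rightarrow> 'a \<Rightarrow> real"
  assumes bilinear: "bilinear B"
    and sym: "B x y = B y x"
    and diag: "q x = B x x"
    and pos: "x \<noteq> 0 \<Longrightarrow> q x > 0"
begin

lemmas bilinear_simps =
  bilinear_ladd[OF bilinear] bilinear_radd[OF bilinear] bilinear_lsub[OF bilinear]
  bilinear_rsub[OF bilinear] bilinear_lmul[OF bilinear] bilinear_rmul[OF bilinear]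
  bilinear_lneg[OF bilinear] bilinear_rneg[OF bilinear] bilinear_lzero[OF bilinear]
  bilinear_rzero[OF bilinear]

lemma pos_def_form: "pos_def_form q"
  unfolding pos_def_form_def using bilinear diag pos by blast

lemma form_add: "q (x + y) = q x + 2 * B x y + q y"
  by (simp add: diag bilinear_simps sym[of y x])

lemma form_diff: "q (x - y) = q x - 2 * B x y + q y"
  by (simp add: diag bilinear_simps sym[of y x])

lemma form_scaleR: "q (k *\<^sub>R x) = k\<^sup>2 * q x"
  by (simp add: diag bilinear_simps power2_eq_square)

lemma form_zero [simp]: "q 0 = 0"
  by (simp add: diag bilinear_simps)

lemma form_eq_0_iff [simp]: "q x = 0 \<longleftrightarrow> x = 0"
  using pos[of x] by (cases "x = 0") auto

lemma form_nonneg: "q x \<ge> 0"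
  using pos[of x] by (cases "x = 0") auto

lemma eq_0_if_orthogonal: "(\<And>y. B x y = 0) \<Longrightarrow> x = 0"
  using diag[of x] by simp

lemma mem_qsphere: "x \<in> qsphere q c r \<longleftrightarrow> r \<ge> 0 \<and> q (x - c) = r\<^sup>2"
  unfolding qsphere_def qnorm_def using form_nonneg[of "x - c"] by auto

lemma qnorm_eq_iff: "qnorm q x = qnorm q y \<longleftrightarrow> q x = q y"
  by (simp add: qnorm_def)

text \<open>Stewart's identity. The subtracted term carries the strict convexity of the
  balls.\<close>

lemma form_convex_combination:
  "q ((1 - u) *\<^sub>R a + u *\<^sub>R b - c) = (1 - u) * q (a - c) + u * q (b - c) - u * (1 - u) * q (a - b)"
proof -
  have e: "(1 - u) *\<^sub>R a + u *\<^sub>R b - c = (1 - u) *\<^sub>R (a - c) + u *\<^sub>R (b - c)"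
    by (simp add: algebra_simps)
  have d: "a - b = (a - c) - (b - c)" by simp
  show ?thesis
    unfolding e d form_add form_diff[of "a - c" "b - c"] form_scaleR
    by (simp add: bilinear_simps) (simp add: algebra_simps power2_eq_square)
qed

lemma convex_form_ball: "convex {x. q (x - c) \<le> \<rho>}"
proof (rule convexI)
  fix a b and u v :: real
  assume a: "a \<in> {x. q (x - c) \<le> \<rho>}" and b: "b \<in> {x. q (x - c) \<le> \<rho>}"
    and uv: "0 \<le> u" "0 \<le> v" "u + v = 1"
  have "u * q (a - c) + v * q (b - c) \<le> u * \<rho> + v * \<rho>"
    using a b uv by (intro add_mono mult_left_mono) auto
  moreover have "0 \<le> v * u * q (a - b)"
    using uv form_nonneg by simp
  moreover have "u * \<rho> + v * \<rho> = \<rho>"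
    using uv by (metis mult.left_neutral distrib_right)
  moreover have "u = 1 - v" using uv by simp
  ultimately show "u *\<^sub>R a + v *\<^sub>R b \<in> {x. q (x - c) \<le> \<rho>}"
    using form_convex_combination[of v a b c] by simp
qed

text \<open>By the subtracted term of \<open>form_convex_combination\<close>, a point strictly
  between two distinct points of the ball lies strictly inside, so it cannot be on the
  sphere.\<close>

lemma polytope_vertices_inscribed:
  assumes "\<And>x. x \<in> X \<Longrightarrow> q (x - c) = \<rho>"
  shows "polytope_vertices (convex hull X) = X"
proof
  show "polytope_vertices (convex hull X) \<subseteq> X"
    unfolding polytope_vertices_def using extreme_point_of_convex_hull by blast
  have hull: "convex hull X \<subseteq> {x. q (x - c) \<le> \<rho>}"
    by (rule hull_minimal) (use assms convex_form_ball in auto)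
  show "X \<subseteq> polytope_vertices (convex hull X)"
  proof
    fix x assume x: "x \<in> X"
    have "x \<notin> open_segment a b" if a: "a \<in> convex hull X" and b: "b \<in> convex hull X" for a b
    proof
      assume "x \<in> open_segment a b"
      then obtain u where u: "0 < u" "u < 1" "x = (1 - u) *\<^sub>R a + u *\<^sub>R b" and ab: "a \<noteq> b"
        unfolding in_segment by blast
      have "q (a - c) \<le> \<rho>" "q (b - c) \<le> \<rho>" using a b hull by auto
      then have "(1 - u) * q (a - c) + u * q (b - c) \<le> (1 - u) * \<rho> + u * \<rho>"
        using u by (intro add_mono mult_left_mono) auto
      moreover have "0 < u * (1 - u) * q (a - b)"
        using u pos[of "a - b"] ab by simp
      moreover have "(1 - u) * \<rho> + u * \<rho> = \<rho>" by (simp add: algebra_simps)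
      ultimately have "q (x - c) < \<rho>"
        using form_convex_combination[of u a b c] u by simp
      then show False using assms[OF x] by simp
    qed
    then show "x \<in> polytope_vertices (convex hull X)"
      unfolding polytope_vertices_def extreme_point_of_def using x by (auto intro: hull_inc)
  qed
qed

text \<open>Polarization: the inner product is a combination of three squared distances among
  \<open>x\<close>, \<open>y\<close>, \<open>z\<close>.\<close>

lemma isometry_inner:
  assumes "isometry_between q q f"
  shows "B (f x - f z) (f y - f z) = B (x - z) (y - z)"
proof -
  have iso: "q (f u - f v) = q (u - v)" for u v
    using assms unfolding isometry_between_def by (simp add: qnorm_def)
  have "q ((f x - f z) - (f y - f z)) = q ((x - z) - (y - z))"
    using iso[of x y] by simp
  then show ?thesis
    unfolding form_diff[of "f x - f z" "f y - f z"] form_diff[of "x - z" "y - z"]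
    using iso[of x z] iso[of y z] by simp
qed

text \<open>After subtracting \<open>f 0\<close> the map preserves \<open>B\<close>. Expanding the
  form at the defects of additivity and homogeneity then gives 0, and definiteness makes the defects
  vanish.\<close>

lemma isometry_affine:
  assumes "isometry_between q q f"
  obtains A where "linear A" "\<And>x y. B (A x) (A y) = B x y" "\<And>x z. f x = f z + A (x - z)"
proof -
  define A where "A x = f x - f 0" for x
  have inner: "B (A x) (A y) = B x y" for x y
    using isometry_inner[OF assms, of x 0 y] by (simp add: A_def)
  have "linear A"
  proof (rule linearI)
    fix x y and k :: real
    have "q (A (x + y) - A x - A y) = 0"
      by (simp add: diag bilinear_simps inner sym[of y x])
    then show "A (x + y) = A x + A y" by (simp add: algebra_simps)
    have "q (A (k *\<^sub>R x) - k *\<^sub>R A x) = 0"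
      by (simp add: diag bilinear_simps inner)
    then show "A (k *\<^sub>R x) = k *\<^sub>R A x" by simp
  qed
  moreover have "f x = f z + A (x - z)" for x z
    using linear_diff[OF \<open>linear A\<close>, of x z] by (simp add: A_def)
  ultimately show ?thesis using inner that by blast
qed

end

text \<open>The bilinear map behind a form may fail to be symmetric; averaging it with its transpose
  keeps the diagonal.\<close>

lemma pos_def_form_imp_definite_form:
  assumes "pos_def_form q"
  obtains B where "definite_form q B"
proof -
  obtain C where C: "bilinear C" "\<And>x. q x = C x x" and pos: "\<And>x. x \<noteq> 0 \<Longrightarrow> q x > 0"
    using assms unfolding pos_def_form_def by blast
  have lin: "linear (C x)" "linear (\<lambda>y. C y x)" for x
    using C(1) unfolding bilinear_def by auto
  have half: "linear (\<lambda>x. f x / 2)" if "linear f" for f :: "'a \<Rightarrow> real"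
    using linear_compose_scale_right[OF that, of "1/2"] by (simp add: linear_iff algebra_simps)
  have "definite_form q (\<lambda>x y. (C x y + C y x) / 2)"
  proof
    show "bilinear (\<lambda>x y. (C x y + C y x) / 2)"
      unfolding bilinear_def by (intro conjI allI half linear_compose_add lin)
  qed (use C pos in auto)
  then show ?thesis by (rule that)
qed

text \<open>Recovers the lattice points of the sphere from the polytope alone, whichever lattice and
  sphere produced it.\<close>

lemma circumscribing_sphere_vertices:
  assumes "pos_def_form q" "circumscribing_sphere q L P c r"
  shows "polytope_vertices P = qsphere q c r \<inter> L"
proof -
  obtain B where "definite_form q B"
    using pos_def_form_imp_definite_form[OF assms(1)] .
  then interpret definite_form q B .
  have "P = convex hull (qsphere q c r \<inter> L)"
    using assms(2) unfolding circumscribing_sphere_def by blast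
  then show ?thesis
    using polytope_vertices_inscribed[of "qsphere q c r \<inter> L" c "r\<^sup>2"] by (simp add: mem_qsphere)
qed

lemma polytope_vertices_affine_image:
  assumes "linear A" "inj A"
  shows "polytope_vertices ((\<lambda>x. A x + b) ` P) = (\<lambda>x. A x + b) ` polytope_vertices P"
proof -
  have seg: "A x + b \<in> open_segment (A u + b) (A v + b) \<longleftrightarrow> x \<in> open_segment u v" for x u v
  proof -
    have "A x + b \<in> open_segment (A u + b) (A v + b) \<longleftrightarrow> A x \<in> open_segment (A u) (A v)"
      by (metis add.commute open_segment_translation_eq)
    also have "\<dots> \<longleftrightarrow> A x \<in> A ` open_segment u v"
      using open_segment_linear_image[OF assms] by simp
    also have "\<dots> \<longleftrightarrow> x \<in> open_segment u v"
      using assms(2) by (simp add: inj_image_mem_iff)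
    finally show ?thesis .
  qed
  have "inj (\<lambda>x. A x + b)" using assms(2) by (auto simp: inj_def)
  then show ?thesis
    unfolding polytope_vertices_def extreme_point_of_def
    by (auto simp: seg inj_image_mem_iff inj_def)
qed

lemma convex_hull_affine_image:
  assumes "linear A"
  shows "(\<lambda>x. A x + b) ` (convex hull S) = convex hull ((\<lambda>x. A x + b) ` S)"
proof -
  have "(\<lambda>x. A x + b) ` T = (+) b ` A ` T" for T
    by (auto simp: image_iff add.commute)
  then show ?thesis
    by (simp add: convex_hull_linear_image[OF assms] convex_hull_translation)
qed

section \<open>Rigidity of the form\<close>

definition P_inner :: "nat \<Rightarrow> (real^'m) \<times> real \<Rightarrow> (real^'m) \<times> real \<Rightarrow> real" where
  "P_inner n x y = (\<Sum>i\<in>UNIV. fst x $ i * fst y $ i) + (real n - 3) / 4 * (snd x * snd y)"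

definition P_center :: "nat \<Rightarrow> (real^'m) \<times> real" where
  "P_center n = (half_vec, - 1 / (real n - 3))"

definition P_vertices :: "((real^'m) \<times> real) set" where
  "P_vertices = layer_a \<union> layer_b \<union> layer_c"

abbreviation unit_vec :: "'m \<Rightarrow> (real^'m) \<times> real" where
  "unit_vec i \<equiv> (axis i 1, 0)"

abbreviation half_point :: "(real^'m) \<times> real" where
  "half_point \<equiv> (half_vec, 0)"

text \<open>Indexing layer 0 by subsets turns parity of the coordinate sum into parity of the
  cardinality, and sign changes about \<open>half_vec\<close> into symmetric differences.\<close>

definition cube_point :: "'m set \<Rightarrow> (real^'m) \<times> real" where
  "cube_point A = (\<chi> i. of_bool (i \<in> A), 0)"

lemma bilinear_P_inner: "bilinear (P_inner n)"
  unfolding bilinear_def linear_iff P_inner_def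
  by (auto simp: sum.distrib field_simps sum_distrib_left)

lemma bilinear_scale:
  fixes f :: "'a::real_vector \<Rightarrow> 'b::real_vector \<Rightarrow> real"
  assumes "bilinear f"
  shows "bilinear (\<lambda>x y. a * f x y)"
  using assms by (simp add: bilinear_def linear_iff algebra_simps)

lemma definite_form_P_form:
  assumes "n > 3"
  shows "definite_form (P_form n) (P_inner n :: (real^'m) \<times> real \<Rightarrow> _)"
proof
  show "bilinear (P_inner n :: (real^'m) \<times> real \<Rightarrow> _)" by (rule bilinear_P_inner)
  fix x y :: "(real^'m) \<times> real"
  show "P_inner n x y = P_inner n y x" by (simp add: P_inner_def mult.commute)
  show "P_form n x = P_inner n x x" by (simp add: P_form_def P_inner_def power2_eq_square)
  assume "x \<noteq> 0"
  then consider "fst x \<noteq> 0" | "snd x \<noteq> 0" by (auto simp: prod_eq_iff)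
  then show "P_form n x > 0"
  proof cases
    case 1
    then obtain i where "fst x $ i \<noteq> 0" by (auto simp: vec_eq_iff)
    then have "(\<Sum>i\<in>UNIV. (fst x $ i)\<^sup>2) > 0"
      by (intro sum_pos2[of UNIV i]) auto
    then show ?thesis using assms by (auto simp: P_form_def intro: add_pos_nonneg)
  next
    case 2
    then show ?thesis using assms
      unfolding P_form_def by (intro add_nonneg_pos sum_nonneg mult_pos_pos) auto
  qed
qed

section \<open>Explicit descriptions of the layers and their span\<close>

lemma cube_point_simps:
  "cube_point {} = 0"
  "i \<noteq> j \<Longrightarrow> cube_point {i, j} = unit_vec i + unit_vec j"
  "distinct [i, j, k, l] \<Longrightarrow> cube_point {i, j, k, l} = unit_vec i + unit_vec j + unit_vec k + unit_vec l"
  by (auto simp: cube_point_def zero_prod_def vec_eq_iff axis_def)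

lemma real_eq_twice_int_iff: "(\<exists>k::int. real a = 2 * of_int k) \<longleftrightarrow> even a"
proof
  assume "\<exists>k::int. real a = 2 * of_int k"
  then obtain k :: int where "real a = 2 * of_int k" by blast
  then have "real_of_int (int a) = real_of_int (2 * k)" by simp
  then have "int a = 2 * k" by (simp only: of_int_eq_iff)
  then show "even a" by presburger
next
  assume "even a"
  then obtain b where "a = 2 * b" by blast
  then show "\<exists>k::int. real a = 2 * of_int k" by (intro exI[of _ "int b"]) simp
qed

lemma layer_b_eq: "layer_b = {cube_point A | A. even (card A)}"
proof -
  have iff: "(\<exists>k::int. (\<Sum>i\<in>UNIV. fst (cube_point A) $ i) = 2 * of_int k) \<longleftrightarrow> even (card A)"
    for A :: "'a set"
  proof -
    have "(\<Sum>i\<in>UNIV. fst (cube_point A) $ i) = real (card A)"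
      by (simp add: cube_point_def sum.If_cases of_bool_def)
    then show ?thesis by (simp only: real_eq_twice_int_iff)
  qed
  have cube: "(x, 0) = cube_point {i. x $ i = 1}" if "\<forall>i. x $ i \<in> {0, 1}" for x :: "real^'a"
    using that by (auto simp: cube_point_def vec_eq_iff)
  show ?thesis
  proof (intro equalityI subsetI)
    fix v :: "(real^'a) \<times> real" assume "v \<in> layer_b"
    then obtain x where x: "v = (x, 0)" "\<forall>i. x $ i \<in> {0, 1}"
      and k: "\<exists>k::int. (\<Sum>i\<in>UNIV. x $ i) = 2 * of_int k"
      unfolding layer_b_def by blast
    from cube[OF x(2)] have "fst (cube_point {i. x $ i = 1}) = x" by (metis fst_conv)
    with k iff[of "{i. x $ i = 1}"] have "even (card {i. x $ i = 1})" by simp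
    with cube[OF x(2)] x(1) show "v \<in> {cube_point A | A. even (card A)}" by blast
  next
    fix v :: "(real^'a) \<times> real" assume "v \<in> {cube_point A | A. even (card A)}"
    then obtain A where A: "v = cube_point A" "even (card A)" by blast
    have v: "v = (fst v, 0)" using A(1) by (simp add: cube_point_def)
    have "\<forall>i. fst v $ i \<in> {0, 1}" using A(1) by (simp add: cube_point_def)
    moreover have "\<exists>k::int. (\<Sum>i\<in>UNIV. fst v $ i) = 2 * of_int k"
      using iff A by metis
    ultimately have "(fst v, 0) \<in> layer_b" unfolding layer_b_def by blast
    then show "v \<in> layer_b" using v by simp
  qed
qed

lemma layer_a_eq: "layer_a = {half_point + (0, 1)}"
  by (simp add: layer_a_def)

lemma layer_c_eq: "layer_c = {half_point - (0, 1) + s *\<^sub>R unit_vec j | s j. s \<in> {1, -1}}"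
  (is "_ = {?f s j | s j. _}")
proof -
  have "{?f s j | s j. s \<in> {1, -1}} = range (?f 1) \<union> range (?f (- 1))" by blast
  moreover have "layer_c = range (?f 1) \<union> range (?f (- 1))"
    unfolding layer_c_def by (auto simp: full_SetCompr_eq)
  ultimately show ?thesis by simp
qed

lemma span_unit_vecs:
  assumes "\<And>i. unit_vec i \<in> span S" "(0, 1) \<in> span S"
  shows "span (S :: ((real^'m) \<times> real) set) = UNIV"
proof -
  have "Basis \<subseteq> span S" using assms by (auto simp: Basis_prod_def Basis_vec_def)
  then show ?thesis by (metis span_Basis span_mono span_span top.extremum_uniqueI)
qed

lemma half_point_eq: "half_point = (\<Sum>i\<in>UNIV. (1/2) *\<^sub>R unit_vec i)"
  by (auto simp: prod_eq_iff fst_sum snd_sum vec_eq_iff half_vec_def axis_def sum_divide_distrib[symmetric])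

lemma obtain_distinct_five:
  fixes p :: "'m::finite"
  assumes "CARD('m) \<ge> 5"
  obtains i j k l :: 'm where "distinct [p, i, j, k, l]"
proof -
  have "card (UNIV - {p}) \<ge> 4" using assms by (simp add: card_Diff_singleton)
  then obtain X where "X \<subseteq> UNIV - {p}" "card X = 4" by (metis obtain_subset_with_card_n)
  then obtain i j k l where "distinct [i, j, k, l]" "X = {i, j, k, l}"
    by (auto simp: card_Suc_eq numeral_eq_Suc)
  with \<open>X \<subseteq> UNIV - {p}\<close> have "distinct [p, i, j, k, l]" by auto
  then show ?thesis by (rule that)
qed

text \<open>Pair sums of unit vectors along a triangle of indices isolate one unit vector; the apex
  then contributes the last axis. As 0 is a vertex, the linear span is also the affine span.\<close>

lemma span_P_vertices:
  assumes "CARD('m::finite) \<ge> 5"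
  shows "span (P_vertices :: ((real^'m) \<times> real) set) = UNIV"
proof (rule span_unit_vecs)
  let ?S = "span (P_vertices :: ((real^'m) \<times> real) set)"
  have pair: "unit_vec i + unit_vec j \<in> ?S" if "i \<noteq> j" for i j :: 'm
  proof -
    have "cube_point {i, j} \<in> P_vertices"
      using that unfolding P_vertices_def layer_b_eq by auto
    then show ?thesis using that by (simp add: cube_point_simps span_base)
  qed
  show unit: "unit_vec i \<in> ?S" for i :: 'm
  proof -
    obtain j k l k' where "distinct [i, j, k, l, k']"
      using obtain_distinct_five[OF assms] .
    then have jk: "i \<noteq> j" "i \<noteq> k" "j \<noteq> k" by auto
    have "unit_vec i = (1/2) *\<^sub>R ((unit_vec i + unit_vec j) + (unit_vec i + unit_vec k) - (unit_vec j + unit_vec k))"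
      by (simp add: vec_eq_iff)
    then show ?thesis using pair jk by (metis span_add span_diff span_scale)
  qed
  have "half_point \<in> ?S" unfolding half_point_eq by (intro span_sum span_scale unit)
  moreover have "half_point + (0, 1) \<in> ?S"
    by (intro span_base) (simp add: P_vertices_def layer_a_eq)
  ultimately show "(0, 1) \<in> ?S" by (metis add_diff_cancel_left' span_diff)
qed

text \<open>The coefficients of a quadratic function vanishing on the cube points of even weight at most
  four satisfy \<open>u\<^sub>i + u\<^sub>j + u\<^sub>k + u\<^sub>l = 0\<close> for all distinct indices, where \<open>u\<^sub>i\<close> is the value at \<open>e\<^sub>i\<close>
  minus the value at \<open>0\<close>; with at least five indices this forces \<open>u = 0\<close>.\<close>

lemma P_form_determined:
  fixes B :: "(real^'m::finite) \<times> real \<Rightarrow> (real^'m) \<times> real \<Rightarrow> real"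
  assumes bil: "bilinear B" and sym: "\<And>x y. B x y = B y x"
    and card: "CARD('m) \<ge> 5" and n: "n = CARD('m) + 1"
    and vanish: "\<And>v. v \<in> P_vertices \<Longrightarrow> B (v - c) (v - c) = \<rho>"
  obtains k where "\<And>x. B x x = k * P_form n x"
proof -
  note [simp] =
    bilinear_ladd[OF bil] bilinear_radd[OF bil] bilinear_lsub[OF bil] bilinear_rsub[OF bil]
    bilinear_lmul[OF bil] bilinear_rmul[OF bil] bilinear_lneg[OF bil] bilinear_rneg[OF bil]
    bilinear_lzero[OF bil] bilinear_rzero[OF bil]
  define e :: "'m \<Rightarrow> (real^'m) \<times> real" where "e i = unit_vec i" for i
  define T :: "(real^'m) \<times> real" where "T = (0, 1)"
  define H :: "(real^'m) \<times> real" where "H = half_point"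
  have H_sum: "H = (\<Sum>i\<in>UNIV. (1/2) *\<^sub>R e i)"
    unfolding H_def e_def by (rule half_point_eq)
  have cube: "cube_point {} = (0 :: (real^'m) \<times> real)"
    "\<And>i j. i \<noteq> j \<Longrightarrow> cube_point {i, j} = e i + e j"
    "\<And>i j k l. distinct [i, j, k, l] \<Longrightarrow> cube_point {i, j, k, l} = e i + e j + e k + e l"
    unfolding e_def by (rule cube_point_simps; assumption)+
  define u where "u i = B (e i) (e i) - 2 * B (e i) c" for i
  have lin: "linear (B x)" "linear (\<lambda>y. B y x)" for x
    using bil unfolding bilinear_def by blast+
  have ce: "B c (e i) = B (e i) c" and Te: "B T (e i) = B (e i) T" for i
    by (simp_all only: sym[of _ "e i"])
  have vb: "B (cube_point A - c) (cube_point A - c) = \<rho>" if "even (card A)" for A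
    using that by (intro vanish) (auto simp: P_vertices_def layer_b_eq)
  have cc: "B c c = \<rho>"
    using vb[of "{}"] by (simp add: cube del: bilinear_lsub[OF bil] bilinear_rsub[OF bil])
  have pair: "u i + u j + 2 * B (e i) (e j) = 0" if "i \<noteq> j" for i j
    using vb[of "{i, j}"] that cc
    by (simp add: cube ce sym[of "e j" "e i"] u_def)
  \<comment> \<open>Each index lies in three of the six pairs, so replacing the mixed terms by
    \<open>pair\<close> turns the sum of the four values into -2 times itself.\<close>
  have four: "u i + u j + u k + u l = 0" if d: "distinct [i, j, k, l]" for i j k l
  proof -
    have "u i + u j + u k + u l + 2 * (B (e i) (e j) + B (e i) (e k) + B (e i) (e l)
       + B (e j) (e k) + B (e j) (e l) + B (e k) (e l)) = 0"
      using vb[of "{i, j, k, l}"] d cc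
      by (simp add: cube(3)[OF d] ce sym[of "e l" "e i"] sym[of "e l" "e j"] sym[of "e l" "e k"] sym[of "e j" "e i"]
          sym[of "e k" "e i"] sym[of "e k" "e j"] u_def)
    then show ?thesis using pair[of i j] pair[of i k] pair[of i l] pair[of j k] pair[of j l] pair[of k l] d
      by simp
  qed
  \<comment> \<open>Quadruples that differ in one index show that the five values agree, and four
    equal values with sum 0 vanish.\<close>
  have u: "u p = 0" for p
  proof -
    obtain i j k l where "distinct [p, i, j, k, l]"
      using obtain_distinct_five[OF card] .
    then show ?thesis
      using four[of p i j k] four[of p i j l] four[of p i k l] four[of p j k l] four[of i j k l] by simp
  qed
  have off: "B (e i) (e j) = 0" if "i \<noteq> j" for i j
    using pair[OF that] u by simp
  have ec: "B (e i) c = B (e i) (e i) / 2" for i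
    using u[of i] by (simp add: u_def)
  have eh: "B (e i) H = B (e i) (e i) / 2" for i
  proof -
    have "B (e i) H = (\<Sum>j\<in>UNIV. B (e i) ((1/2) *\<^sub>R e j))"
      unfolding H_sum by (rule linear_sum[OF lin(1)])
    also have "\<dots> = (\<Sum>j\<in>UNIV. if j = i then B (e i) (e i) / 2 else 0)"
      by (intro sum.cong) (auto simp: off)
    finally show ?thesis by simp
  qed
  \<comment> \<open>The offset of the center from \<open>H\<close> turns out orthogonal to all
    \<open>e i\<close>, so only its products with itself and with \<open>T\<close> remain
    unknown.\<close>
  define D where "D = H - c"
  have eD: "B (e i) D = 0" for i
    by (simp add: D_def ec eh)
  have De: "B D (e i) = 0" for i
    using eD sym by metis
  have va: "B (D + T) (D + T) = \<rho>"
  proof -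
    have "H + T \<in> P_vertices" unfolding P_vertices_def layer_a_eq H_def T_def by blast
    moreover have "H + T - c = D + T" by (simp add: D_def)
    ultimately show ?thesis using vanish by metis
  qed
  have vc: "B (D - T + s *\<^sub>R e j) (D - T + s *\<^sub>R e j) = \<rho>" if "s \<in> {1, -1}" for s j
  proof -
    have "H - T + s *\<^sub>R e j \<in> P_vertices"
      unfolding P_vertices_def layer_c_eq H_def T_def e_def using that by blast
    moreover have "H - T + s *\<^sub>R e j - c = D - T + s *\<^sub>R e j" by (simp add: D_def)
    ultimately show ?thesis using vanish by metis
  qed
  \<comment> \<open>The two vertices of layer -1 belonging to \<open>j\<close> differ only in the
    sign of the term linear in \<open>e j\<close>.\<close>
  have eT: "B (e j) T = 0" for j
    using vc[of 1 j] vc[of "-1" j] eD[of j] De[of j] by (simp add: Te)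
  have ea: "B (e j) (e j) = \<rho> - B (D - T) (D - T)" for j
    using vc[of 1 j] eD[of j] De[of j] eT[of j] by (simp add: Te)
  define a where "a = \<rho> - B (D - T) (D - T)"
  have ee: "B (e i) (e j) = (if i = j then a else 0)" for i j
    using off ea by (auto simp: a_def)
  have sum_half: "B H x = (\<Sum>i\<in>UNIV. (1/2) * B (e i) x)" for x
  proof -
    have "B H x = (\<Sum>i\<in>UNIV. B ((1/2) *\<^sub>R e i) x)"
      unfolding H_sum by (rule linear_sum[OF lin(2)])
    then show ?thesis by simp
  qed
  have hh: "B H H = CARD('m) * a / 4"
    by (simp add: sum_half eh ee)
  have hD: "B H D = 0" by (simp add: sum_half eD)
  have "c = H - D" by (simp add: D_def)
  then have "\<rho> = B (H - D) (H - D)" using cc by simp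
  then have rho: "\<rho> = CARD('m) * a / 4 + B D D"
    by (simp add: hh hD sym[of D H])
  have "B (D + T) (D + T) = B D D + 2 * B D T + B T T"
    "B (D - T) (D - T) = B D D - 2 * B D T + B T T"
    by (simp_all add: sym[of T D])
  \<comment> \<open>The apex and layer -1, each compared with the vertex 0. Adding the equations
    eliminates \<open>B D T\<close>, and CARD('m) = n - 1 produces the factor (n - 3)/4.\<close>
  then have "2 * B D T + B T T = CARD('m) * a / 4" "B T T - 2 * B D T + a = CARD('m) * a / 4"
    using va rho a_def by linarith+
  then have TT: "B T T = (real n - 3) / 4 * a"
    by (simp add: n field_simps)
  have "B = (\<lambda>x y. a * P_inner n x y)"
  proof (rule bilinear_eq_stdbasis[OF bil])
    show "bilinear (\<lambda>x y. a * P_inner n x y)"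
      by (rule bilinear_scale[OF bilinear_P_inner])
    have basis: "(Basis :: ((real^'m) \<times> real) set) = insert T (range e)"
      by (auto simp: Basis_prod_def Basis_vec_def T_def e_def)
    have P: "P_inner n (e i) (e j) = (if i = j then 1 else 0)" "P_inner n (e i) T = 0"
      "P_inner n T (e i) = 0" "P_inner n T T = (real n - 3) / 4" for i j
      by (auto simp: e_def T_def P_inner_def axis_def if_distrib[of "\<lambda>x. x * _"] cong: if_cong)
    fix x y :: "(real^'m) \<times> real" assume "x \<in> Basis" "y \<in> Basis"
    then show "B x y = a * P_inner n x y"
      unfolding basis by (elim insertE rangeE) (simp_all only: ee eT TT Te P, auto)
  qed
  then have "B x x = a * P_form n x" for x
    by (simp add: P_inner_def P_form_def power2_eq_square)
  then show ?thesis by (rule that)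
qed

section \<open>The lattice and the empty sphere\<close>

lemma group_closure_of_int_scaleR:
  fixes s :: "'a::real_vector"
  assumes "s \<in> group_closure S"
  shows "of_int k *\<^sub>R s \<in> group_closure S"
proof -
  have nat: "real j *\<^sub>R s \<in> group_closure S" for j
    by (induction j) (auto simp: scaleR_add_left intro: group_closure_add assms)
  show ?thesis
  proof (cases "k \<ge> 0")
    case True
    then show ?thesis using nat[of "nat k"] by simp
  next
    case False
    then have "of_int k *\<^sub>R s = - (real (nat (- k)) *\<^sub>R s)" by simp
    then show ?thesis using nat[of "nat (- k)"] by (metis group_closure_minus_iff)
  qed
qed

lemma sum_in_group_closure:
  fixes f :: "'b \<Rightarrow> 'a::ab_group_add"
  assumes "\<And>i. i \<in> I \<Longrightarrow> f i \<in> group_closure S"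
  shows "sum f I \<in> group_closure S"
  using assms by (induction I rule: infinite_finite_induct) (auto intro: group_closure_add)

lemma group_closure_subset:
  assumes "S \<subseteq> group_closure T"
  shows "group_closure S \<subseteq> group_closure T"
proof
  fix x assume "x \<in> group_closure S"
  then show "x \<in> group_closure T"
    using assms by induction (auto intro: group_closure.diff)
qed

lemma D_lattice_diff:
  assumes "x \<in> D_lattice" "y \<in> D_lattice"
  shows "x - y \<in> D_lattice"
proof -
  obtain k l :: int where "(\<Sum>i\<in>UNIV. x $ i) = 2 * of_int k" "(\<Sum>i\<in>UNIV. y $ i) = 2 * of_int l"
    using assms unfolding D_lattice_def by blast
  then have "(\<Sum>i\<in>UNIV. (x - y) $ i) = 2 * of_int (k - l)"
    by (simp add: sum_subtractf)
  moreover have "\<forall>i. (x - y) $ i \<in> \<int>" using assms unfolding D_lattice_def by auto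
  ultimately show ?thesis unfolding D_lattice_def by blast
qed

lemma zero_in_D_lattice: "0 \<in> D_lattice"
  unfolding D_lattice_def by (auto intro: exI[of _ 0])

text \<open>The last coordinate counts the copies of the generator \<open>(half_vec, 1)\<close>;
  once these are removed, only a vector of \<open>D_lattice\<close> can remain.\<close>

lemma L_lattice_iff:
  "v \<in> L_lattice \<longleftrightarrow> (\<exists>k::int. snd v = of_int k \<and> fst v - of_int k *\<^sub>R half_vec \<in> D_lattice)"
proof
  assume "v \<in> L_lattice"
  then show "\<exists>k::int. snd v = of_int k \<and> fst v - of_int k *\<^sub>R half_vec \<in> D_lattice"
    unfolding L_lattice_def
  proof induction
    case (base s)
    then consider "s = 0" | x where "x \<in> D_lattice" "s = (x, 0)" | "s = (half_vec, 1)" by blast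
    then show ?case
    proof cases
      case 1
      then show ?thesis by (intro exI[of _ 0]) (simp add: zero_in_D_lattice)
    next
      case 2
      then show ?thesis by (intro exI[of _ 0]) simp
    next
      case 3
      then show ?thesis by (intro exI[of _ 1]) (simp add: zero_in_D_lattice)
    qed
  next
    case (diff s t)
    then obtain k l :: int where kl: "snd s = of_int k" "fst s - of_int k *\<^sub>R half_vec \<in> D_lattice"
      "snd t = of_int l" "fst t - of_int l *\<^sub>R half_vec \<in> D_lattice" by blast
    have "fst (s - t) - of_int (k - l) *\<^sub>R half_vec
        = (fst s - of_int k *\<^sub>R half_vec) - (fst t - of_int l *\<^sub>R half_vec)"
      by (simp add: algebra_simps)
    then have "fst (s - t) - of_int (k - l) *\<^sub>R half_vec \<in> D_lattice"
      using D_lattice_diff[OF kl(2) kl(4)] by (simp only:)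
    then show ?case using kl by (intro exI[of _ "k - l"]) simp
  qed
next
  assume "\<exists>k::int. snd v = of_int k \<and> fst v - of_int k *\<^sub>R half_vec \<in> D_lattice"
  then obtain k :: int where k: "snd v = of_int k" "fst v - of_int k *\<^sub>R half_vec \<in> D_lattice"
    by blast
  have "v = (fst v - of_int k *\<^sub>R half_vec, 0) + of_int k *\<^sub>R (half_vec, 1)"
    using k(1) by (simp add: prod_eq_iff)
  moreover have "(fst v - of_int k *\<^sub>R half_vec, 0) \<in> L_lattice"
    unfolding L_lattice_def using k(2) by (intro group_closure.base) blast
  moreover have "of_int k *\<^sub>R (half_vec, 1) \<in> L_lattice"
    unfolding L_lattice_def by (intro group_closure_of_int_scaleR group_closure.base) blast
  ultimately show "v \<in> L_lattice"
    unfolding L_lattice_def using group_closure_add by fastforce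
qed

text \<open>An integral basis whose coefficients can be read off: the one at an index other than
  \<open>i0\<close> is the coordinate itself, and the one at \<open>i0\<close> is half of the
  coordinate sum.\<close>

definition D_basis :: "'m \<Rightarrow> 'm \<Rightarrow> real^'m" where
  "D_basis i0 i = (if i = i0 then 2 *\<^sub>R axis i0 1 else axis i 1 - axis i0 1)"

lemma D_basis_in_D_lattice: "D_basis i0 i \<in> D_lattice"
  by (auto simp: D_basis_def D_lattice_def axis_def sum_subtractf simp flip: sum_distrib_left
      intro: exI[of _ 0] exI[of _ 1])

lemma D_lattice_combination:
  fixes x :: "real^'m::finite"
  assumes "x \<in> D_lattice"
  obtains a where "x = (\<Sum>i\<in>UNIV. of_int (a i) *\<^sub>R D_basis i0 i)"
proof -
  obtain k :: int where k: "(\<Sum>i\<in>UNIV. x $ i) = 2 * of_int k"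
    using assms unfolding D_lattice_def by blast
  have "\<forall>i. \<exists>b::int. x $ i = of_int b"
    using assms unfolding D_lattice_def by (auto elim!: Ints_cases)
  then obtain b :: "'m \<Rightarrow> int" where b: "\<And>i. x $ i = of_int (b i)" by metis
  define a where "a = b(i0 := k)"
  have "(\<Sum>i\<in>UNIV. of_int (a i) *\<^sub>R D_basis i0 i)
      = (2 * of_int k) *\<^sub>R axis i0 1 + (\<Sum>i\<in>UNIV - {i0}. (x $ i) *\<^sub>R (axis i 1 - axis i0 1))"
    by (subst sum.remove[of _ i0]) (auto simp: a_def b D_basis_def intro!: sum.cong)
  also have "(\<Sum>i\<in>UNIV - {i0}. (x $ i) *\<^sub>R (axis i 1 - axis i0 1))
      = (\<Sum>i\<in>UNIV. (x $ i) *\<^sub>R (axis i 1 - axis i0 1))"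
    by (subst (2) sum.remove[of _ i0]) auto
  also have "\<dots> = (\<Sum>i\<in>UNIV. (x $ i) *\<^sub>R axis i 1) - (\<Sum>i\<in>UNIV. x $ i) *\<^sub>R axis i0 1"
    by (simp add: scaleR_diff_right sum_subtractf scaleR_sum_left)
  also have "(\<Sum>i\<in>UNIV. (x $ i) *\<^sub>R axis i 1) = x"
    by (simp add: vec_eq_iff axis_def if_distrib[of "\<lambda>x. _ * x"] cong: if_cong)
  finally show ?thesis using k by (intro that[of a]) simp
qed

lemma full_lattice_L_lattice: "full_lattice (L_lattice :: ((real^'m::finite) \<times> real) set)"
proof -
  obtain i0 :: 'm where True by simp
  define S :: "((real^'m) \<times> real) set" where
    "S = insert (half_vec, 1) (range (\<lambda>i. (D_basis i0 i, 0)))"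
  have closure: "group_closure S = L_lattice"
  proof
    show "group_closure S \<subseteq> L_lattice"
      unfolding L_lattice_def using D_basis_in_D_lattice
      by (intro group_closure_subset) (auto simp: S_def intro: group_closure.base)
    have "(x, 0) \<in> group_closure S" if x: "x \<in> D_lattice" for x :: "real^'m"
    proof -
      obtain a where a: "x = (\<Sum>i\<in>UNIV. of_int (a i) *\<^sub>R D_basis i0 i)"
        using D_lattice_combination[OF x] .
      have "(x, 0) = (\<Sum>i\<in>UNIV. of_int (a i) *\<^sub>R (D_basis i0 i, 0))"
        by (simp add: prod_eq_iff fst_sum snd_sum a)
      also have "\<dots> \<in> group_closure S"
        by (intro sum_in_group_closure group_closure_of_int_scaleR group_closure.base)
          (auto simp: S_def)
      finally show ?thesis .
    qed
    then show "L_lattice \<subseteq> group_closure S"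
      unfolding L_lattice_def
      by (intro group_closure_subset) (auto simp: S_def intro: group_closure.base)
  qed
  have span: "span S = UNIV"
  proof (rule span_unit_vecs)
    have b: "(D_basis i0 i, 0) \<in> span S" for i
      by (intro span_base) (auto simp: S_def)
    have "unit_vec i0 = (1/2) *\<^sub>R (D_basis i0 i0, 0::real)" by (simp add: D_basis_def)
    then have i0: "unit_vec i0 \<in> span S" using b span_scale by metis
    show unit: "unit_vec i \<in> span S" for i
    proof (cases "i = i0")
      case False
      then have "unit_vec i = (D_basis i0 i, 0::real) + unit_vec i0" by (simp add: D_basis_def)
      then show ?thesis using b i0 span_add by metis
    qed (use i0 in simp)
    have "half_point \<in> span S" unfolding half_point_eq by (intro span_sum span_scale unit)
    moreover have "(half_vec, 1) \<in> span S" by (intro span_base) (simp add: S_def)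
    moreover have "(0, 1) = (half_vec, 1) - half_point" by simp
    ultimately show "(0, 1) \<in> span S" by (metis span_diff)
  qed
  \<comment> \<open>Independence comes from counting: a spanning set with at most as many elements
    as the dimension is independent, so an upper bound on the cardinality suffices.\<close>
  have "card S \<le> Suc (card (range (\<lambda>i. (D_basis i0 i, 0::real))))"
    unfolding S_def by (simp add: card_insert_if)
  also have "\<dots> \<le> Suc (CARD('m))" by (simp add: card_image_le)
  finally have "card S \<le> dim (UNIV :: ((real^'m) \<times> real) set)" by (simp add: dim_UNIV)
  then have "independent S"
    using card_le_dim_spanning[of S UNIV] span by (auto simp: S_def)
  then show ?thesis unfolding full_lattice_def using span closure by metis
qed

lemma integer_vector_norm_ge_1:
  fixes w :: "'m::finite \<Rightarrow> real"
  assumes int: "\<And>i. w i \<in> \<int>" and nz: "\<exists>i. w i \<noteq> 0"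
  shows "(\<Sum>i\<in>UNIV. (w i)\<^sup>2) \<ge> 1"
    and "(\<Sum>i\<in>UNIV. (w i)\<^sup>2) = 1 \<Longrightarrow> \<exists>j s. s \<in> {1, - 1} \<and> w = (\<lambda>i. if i = j then s else 0)"
proof -
  obtain j where j: "w j \<noteq> 0" using nz by blast
  obtain b :: int where b: "w j = of_int b" using int by (auto elim: Ints_cases)
  have "b\<^sup>2 \<ge> 1" using j b by (simp add: int_one_le_iff_zero_less)
  then have sq: "(w j)\<^sup>2 \<ge> 1" unfolding b by (metis of_int_1 of_int_le_iff of_int_power)
  have split: "(\<Sum>i\<in>UNIV. (w i)\<^sup>2) = (w j)\<^sup>2 + (\<Sum>i\<in>UNIV - {j}. (w i)\<^sup>2)"
    by (simp add: sum.remove)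
  moreover have "(\<Sum>i\<in>UNIV - {j}. (w i)\<^sup>2) \<ge> 0" by (intro sum_nonneg) simp
  ultimately show "(\<Sum>i\<in>UNIV. (w i)\<^sup>2) \<ge> 1" using sq by linarith
  assume "(\<Sum>i\<in>UNIV. (w i)\<^sup>2) = 1"
  with split sq \<open>(\<Sum>i\<in>UNIV - {j}. (w i)\<^sup>2) \<ge> 0\<close>
  have "(\<Sum>i\<in>UNIV - {j}. (w i)\<^sup>2) = 0" "(w j)\<^sup>2 = 1" by linarith+
  then have "w i = 0" if "i \<noteq> j" for i using that by (simp add: sum_nonneg_eq_0_iff)
  moreover have "w j \<in> {1, - 1}" using \<open>(w j)\<^sup>2 = 1\<close> by (simp add: power2_eq_1_iff)
  ultimately show "\<exists>j s. s \<in> {1, - 1} \<and> w = (\<lambda>i. if i = j then s else 0)"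
    by (intro exI[of _ j] exI[of _ "w j"]) auto
qed


text \<open>The \<open>itself\<close> argument fixes the index type, which ties \<open>n\<close> to
  the dimension of the space.\<close>

locale P_setting =
  fixes n :: nat and type :: "'m::finite itself"
  assumes n_ge: "n \<ge> 6" and even_n: "even n" and card_index: "CARD('m) = n - 1"

sublocale P_setting \<subseteq> definite_form "P_form n" "P_inner n :: (real^'m) \<times> real \<Rightarrow> _"
  using n_ge by (intro definite_form_P_form) simp

context P_setting
begin

lemma n_eq: "n = CARD('m) + 1" and card_ge: "CARD('m) \<ge> 5" and odd_card: "odd (CARD('m))"
  using n_ge even_n card_index by auto

lemma real_n: "real n \<ge> 6" and real_card: "real (CARD('m)) = real n - 1"
  using n_ge card_index by auto

lemma snd_P_center: "snd (P_center n :: (real^'m) \<times> real) = - 1 / (real n - 3)"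
  and fst_P_center: "fst (P_center n :: (real^'m) \<times> real) = half_vec"
  by (simp_all add: P_center_def)

section \<open>Distances of vertices and lattice points from the center\<close>

definition radius_sq :: real where "radius_sq = (real n - 2)\<^sup>2 / (4 * (real n - 3))"

lemma P_form_diff_center:
  "P_form n (v - P_center n :: (real^'m) \<times> real) =
     (\<Sum>i\<in>UNIV. (fst v $ i - 1/2)\<^sup>2) + ((real n - 3) * snd v + 1)\<^sup>2 / (4 * (real n - 3))"
proof -
  have e: "N / 4 * (t - - 1 / N)\<^sup>2 = (N * t + 1)\<^sup>2 / (4 * N)" if "N > 0" for N t :: real
    using that by (simp add: field_simps power2_eq_square)
  have "(real n - 3) / 4 * (snd v - - 1 / (real n - 3))\<^sup>2 = ((real n - 3) * snd v + 1)\<^sup>2 / (4 * (real n - 3))"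
    by (rule e) (use real_n in simp)
  then show ?thesis
    by (simp only: P_form_def fst_diff snd_diff fst_P_center snd_P_center vector_minus_component
        half_vec_def vec_lambda_beta)
qed

text \<open>At heights 0, 1 and -1 the vertical term equals \<open>radius_sq\<close> minus (n -
  1)/4, 0 and 1. What is missing is exactly the squared distance from \<open>half_vec\<close> to a
  corner of the cube, to itself and to a neighbour one unit away.\<close>

lemma P_form_diff_center_layers:
  fixes v :: "(real^'m) \<times> real"
  shows "snd v = 0 \<Longrightarrow> P_form n (v - P_center n) - radius_sq = (\<Sum>i\<in>UNIV. (fst v $ i - 1/2)\<^sup>2 - 1/4)"
    and "snd v = 1 \<Longrightarrow> P_form n (v - P_center n) - radius_sq = (\<Sum>i\<in>UNIV. (fst v $ i - 1/2)\<^sup>2)"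
    and "snd v = - 1 \<Longrightarrow> P_form n (v - P_center n) - radius_sq = (\<Sum>i\<in>UNIV. (fst v $ i - 1/2)\<^sup>2) - 1"
proof -
  define N where "N = real n - 3"
  have N: "N > 0" "real n - 3 = N" "real n - 2 = N + 1" "real (CARD('m)) = N + 2"
    using real_n real_card by (simp_all add: N_def)
  have layers: "1 / (4 * N) = (N + 1)\<^sup>2 / (4 * N) - (N + 2) / 4"
    "(1 - N)\<^sup>2 / (4 * N) = (N + 1)\<^sup>2 / (4 * N) - 1"
    using N(1) by (simp_all add: field_simps power2_eq_square)
  show "snd v = 0 \<Longrightarrow> P_form n (v - P_center n) - radius_sq = (\<Sum>i\<in>UNIV. (fst v $ i - 1/2)\<^sup>2 - 1/4)"
    "snd v = 1 \<Longrightarrow> P_form n (v - P_center n) - radius_sq = (\<Sum>i\<in>UNIV. (fst v $ i - 1/2)\<^sup>2)"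
    "snd v = - 1 \<Longrightarrow> P_form n (v - P_center n) - radius_sq = (\<Sum>i\<in>UNIV. (fst v $ i - 1/2)\<^sup>2) - 1"
    unfolding P_form_diff_center radius_sq_def sum_subtractf N by (simp_all add: N(4) layers)
qed

lemma P_vertices_on_sphere:
  assumes "v \<in> (P_vertices :: ((real^'m) \<times> real) set)"
  shows "P_form n (v - P_center n) = radius_sq"
proof -
  consider "v \<in> layer_a" | "v \<in> layer_b" | "v \<in> layer_c"
    using assms unfolding P_vertices_def by blast
  then show ?thesis
  proof cases
    case 1
    then have v: "snd v = 1" "\<And>i. (fst v $ i - 1/2)\<^sup>2 = 0" by (auto simp: layer_a_def half_vec_def)
    have "(\<Sum>i\<in>UNIV. (fst v $ i - 1/2)\<^sup>2) = 0" by (intro sum.neutral ballI v)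
    then show ?thesis using P_form_diff_center_layers(2)[OF v(1)] by linarith
  next
    case 2
    then obtain x where x: "v = (x, 0)" "\<And>i. x $ i \<in> {0, 1}" unfolding layer_b_def by blast
    have "(fst v $ i - 1/2)\<^sup>2 - 1/4 = 0" for i
      using x(2)[of i] by (auto simp: x(1) power2_eq_square)
    then have "(\<Sum>i\<in>UNIV. (fst v $ i - 1/2)\<^sup>2 - 1/4) = 0" by (intro sum.neutral ballI)
    then show ?thesis using P_form_diff_center_layers(1)[of v] x(1) by simp
  next
    case 3
    then obtain s j where s: "s \<in> {1, -1}" and v: "v = half_point - (0, 1) + s *\<^sub>R unit_vec j"
      unfolding layer_c_eq by blast
    have "(fst v $ i - 1/2)\<^sup>2 = (if i = j then 1 else 0)" for i
      using s by (auto simp: v half_vec_def axis_def)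
    then show ?thesis using P_form_diff_center_layers(3)[of v] v by simp
  qed
qed

lemma P_vertices_subset_L_lattice: "(P_vertices :: ((real^'m) \<times> real) set) \<subseteq> L_lattice"
proof
  fix v :: "(real^'m) \<times> real" assume "v \<in> P_vertices"
  then consider "v \<in> layer_a" | "v \<in> layer_b" | "v \<in> layer_c"
    unfolding P_vertices_def by blast
  then show "v \<in> L_lattice"
  proof cases
    case 1
    then show ?thesis unfolding L_lattice_iff
      by (intro exI[of _ 1]) (auto simp: layer_a_def zero_in_D_lattice)
  next
    case 2
    then obtain x where x: "v = (x, 0)" "\<forall>i. x $ i \<in> {0, 1}"
      and k: "\<exists>k::int. (\<Sum>i\<in>UNIV. x $ i) = 2 * of_int k" unfolding layer_b_def by blast
    have "x $ i \<in> \<int>" for i using x(2)[rule_format, of i] by auto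
    then have "x \<in> D_lattice" using k unfolding D_lattice_def by blast
    then show ?thesis unfolding L_lattice_iff
      by (intro exI[of _ 0]) (simp add: x(1))
  next
    case 3
    then obtain s :: real and j where s: "s \<in> {1, -1}" and v: "v = half_point - (0, 1) + s *\<^sub>R unit_vec j"
      unfolding layer_c_eq by blast
    let ?x = "fst v - of_int (- 1) *\<^sub>R half_vec"
    have x: "?x $ i = 1 + (if i = j then s else 0)" for i
      by (auto simp: v half_vec_def axis_def)
    \<comment> \<open>After adding \<open>half_vec\<close> the coordinate sum is n - 1 plus or minus
      1, which is even because n - 1 is odd.\<close>
    obtain h where h: "CARD('m) = 2 * h + 1" using odd_card by (auto elim: oddE)
    have "(\<Sum>i\<in>UNIV. ?x $ i) = real (CARD('m)) + s"
      unfolding x by (simp add: sum.distrib)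
    also have "\<dots> = 2 * of_int (int h + (if s = 1 then 1 else 0))"
      using s h by auto
    finally have "\<exists>k::int. (\<Sum>i\<in>UNIV. ?x $ i) = 2 * of_int k" by blast
    moreover have "?x $ i \<in> \<int>" for i using s unfolding x by auto
    ultimately have "?x \<in> D_lattice" unfolding D_lattice_def by blast
    then show ?thesis unfolding L_lattice_iff
      by (intro exI[of _ "- 1"]) (simp add: v)
  qed
qed

text \<open>The difference of the two sides is x (x - 1), and no integer lies strictly between 0 and
  1.\<close>

lemma integer_half_distance:
  assumes "x \<in> \<int>"
  shows "(x - 1/2)\<^sup>2 \<ge> (1/4 :: real)" and "(x - 1/2)\<^sup>2 = 1/4 \<Longrightarrow> x \<in> {0, 1}"
proof -
  obtain b :: int where b: "x = of_int b" using assms by (auto elim: Ints_cases)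
  have "b * (b - 1) \<ge> 0" by (cases "b \<ge> 1") (auto simp: mult_nonpos_nonpos)
  then have "x * (x - 1) \<ge> 0" unfolding b by (metis of_int_0_le_iff of_int_1 of_int_diff of_int_mult)
  then show "(x - 1/2)\<^sup>2 \<ge> 1/4" by (simp add: power2_eq_square algebra_simps)
  assume "(x - 1/2)\<^sup>2 = 1/4"
  then have "x * (x - 1) = 0" by (simp add: power2_eq_square algebra_simps)
  then show "x \<in> {0, 1}" by simp
qed

lemma L_lattice_outside_sphere:
  assumes "v \<in> (L_lattice :: ((real^'m) \<times> real) set)"
  shows "P_form n (v - P_center n) \<ge> radius_sq"
    and "P_form n (v - P_center n) = radius_sq \<Longrightarrow> v \<in> P_vertices"
proof -
  obtain k :: int where k: "snd v = of_int k" and D: "fst v - of_int k *\<^sub>R half_vec \<in> D_lattice"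
    using assms unfolding L_lattice_iff by blast
  have "P_form n (v - P_center n) \<ge> radius_sq \<and>
    (P_form n (v - P_center n) = radius_sq \<longrightarrow> v \<in> P_vertices)"
  proof -
    consider "k = 0" | "k = 1" | "k = - 1" | "k \<ge> 2 \<or> k \<le> - 2" by linarith
    then show ?thesis
    proof cases
      case 1
      have int: "fst v $ i \<in> \<int>" for i using D 1 unfolding D_lattice_def by simp
      note ge = integer_half_distance(1)[OF int]
      have e: "P_form n (v - P_center n) - radius_sq = (\<Sum>i\<in>UNIV. (fst v $ i - 1/2)\<^sup>2 - 1/4)"
        using P_form_diff_center_layers(1) k 1 by simp
      have nonneg: "(\<Sum>i\<in>UNIV. (fst v $ i - 1/2)\<^sup>2 - 1/4) \<ge> 0"
        by (rule sum_nonneg) (use ge in simp)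
      show ?thesis
      proof (intro conjI impI)
        assume "P_form n (v - P_center n) = radius_sq"
        then have "(\<Sum>i\<in>UNIV. (fst v $ i - 1/2)\<^sup>2 - 1/4) = 0" using e by simp
        then have "(fst v $ i - 1/2)\<^sup>2 - 1/4 = 0" for i
          using ge by (subst (asm) sum_nonneg_eq_0_iff) auto
        then have "\<forall>i. fst v $ i \<in> {0, 1}" using integer_half_distance(2)[OF int] by simp
        moreover have "v = (fst v, 0)" using k 1 by (simp add: prod_eq_iff)
        ultimately have "v \<in> layer_b" using D 1 unfolding layer_b_def D_lattice_def by simp metis
        then show "v \<in> P_vertices" by (simp add: P_vertices_def)
      qed (use e nonneg in linarith)
    next
      case 2
      have e: "P_form n (v - P_center n) - radius_sq = (\<Sum>i\<in>UNIV. (fst v $ i - 1/2)\<^sup>2)"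
        using P_form_diff_center_layers(2) k 2 by simp
      have nonneg: "(\<Sum>i\<in>UNIV. (fst v $ i - 1/2)\<^sup>2) \<ge> 0" by (rule sum_nonneg) simp
      show ?thesis
      proof (intro conjI impI)
        assume "P_form n (v - P_center n) = radius_sq"
        then have "(\<Sum>i\<in>UNIV. (fst v $ i - 1/2)\<^sup>2) = 0" using e by simp
        then have "fst v $ i = 1/2" for i by (subst (asm) sum_nonneg_eq_0_iff) auto
        then have "v \<in> layer_a" using k 2 by (simp add: layer_a_def prod_eq_iff vec_eq_iff half_vec_def)
        then show "v \<in> P_vertices" by (simp add: P_vertices_def)
      qed (use e nonneg in linarith)
    next
      case 3
      define w where "w i = fst v $ i - 1/2" for i
      have e: "P_form n (v - P_center n) - radius_sq = (\<Sum>i\<in>UNIV. (w i)\<^sup>2) - 1"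
        using P_form_diff_center_layers(3) k 3 by (simp add: w_def)
      have int: "fst v $ i + 1/2 \<in> \<int>" for i
        using D 3 unfolding D_lattice_def by (simp add: half_vec_def)
      have w: "w i \<in> \<int>" for i
        using Ints_diff[OF int[of i] Ints_1] by (simp add: w_def)
      have "\<exists>i. w i \<noteq> 0"
      proof (rule ccontr)
        assume "\<not> ?thesis"
        then have "fst v $ i = 1/2" for i by (auto simp: w_def)
        then have "fst v = half_vec" by (simp add: vec_eq_iff half_vec_def)
        then obtain l :: int where "(\<Sum>i\<in>UNIV. (half_vec + half_vec :: real^'m) $ i) = 2 * of_int l"
          using D 3 unfolding D_lattice_def by auto
        then have "\<exists>l::int. real (CARD('m)) = 2 * of_int l" by (auto simp: half_vec_def)
        then show False using odd_card by (simp only: real_eq_twice_int_iff)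
      qed
      note w1 = integer_vector_norm_ge_1[OF w this]
      show ?thesis
      proof (intro conjI impI)
        assume "P_form n (v - P_center n) = radius_sq"
        then have "(\<Sum>i\<in>UNIV. (w i)\<^sup>2) = 1" using e by simp
        then obtain j s where s: "s \<in> {1, - 1}" and "w = (\<lambda>i. if i = j then s else 0)"
          using w1(2) by blast
        then have "fst v $ i = 1/2 + (if i = j then s else 0)" for i
          using w_def[of i] by simp
        then have "v = half_point - (0, 1) + s *\<^sub>R unit_vec j"
          using k 3 by (auto simp: prod_eq_iff vec_eq_iff half_vec_def axis_def)
        then show "v \<in> P_vertices" using s unfolding P_vertices_def layer_c_eq by blast
      qed (use e w1(1) in linarith)
    next
      case 4
      \<comment> \<open>For these heights the vertical term alone exceeds \<open>radius_sq\<close>: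
        with N = n - 3 the right side is at least 2 N - 1, and 2 N - 1 > N + 1 since N is at least
        3.\<close>
      have "real n - 2 < \<bar>(real n - 3) * real_of_int k + 1\<bar>"
      proof -
        have "(real n - 3) * \<bar>real_of_int k\<bar> \<ge> (real n - 3) * 2"
          using 4 real_n by (intro mult_left_mono) auto
        moreover have "\<bar>(real n - 3) * real_of_int k\<bar> = (real n - 3) * \<bar>real_of_int k\<bar>"
          using real_n by (simp add: abs_mult)
        ultimately have "\<bar>(real n - 3) * real_of_int k\<bar> \<ge> 2 * real n - 6" by simp
        then show ?thesis
          using real_n abs_triangle_ineq4[of "(real n - 3) * real_of_int k + 1" 1] by simp
      qed
      then have "(real n - 2)\<^sup>2 < \<bar>(real n - 3) * real_of_int k + 1\<bar>\<^sup>2"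
        using real_n by (intro power_strict_mono) auto
      then have "(real n - 2)\<^sup>2 < ((real n - 3) * real_of_int k + 1)\<^sup>2" by simp
      then have "radius_sq < ((real n - 3) * snd v + 1)\<^sup>2 / (4 * (real n - 3))"
        unfolding radius_sq_def k using real_n by (intro divide_strict_right_mono) auto
      moreover have "(\<Sum>i\<in>UNIV. (fst v $ i - 1/2)\<^sup>2) \<ge> 0" by (rule sum_nonneg) simp
      ultimately show ?thesis unfolding P_form_diff_center by linarith
    qed
  qed
  then show "P_form n (v - P_center n) \<ge> radius_sq"
    and "P_form n (v - P_center n) = radius_sq \<Longrightarrow> v \<in> P_vertices" by blast+
qed

definition radius :: real where "radius = (real n - 2) / (2 * sqrt (real n - 3))"

lemma radius_nonneg: "radius \<ge> 0" and radius_square: "radius\<^sup>2 = radius_sq"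
  unfolding radius_def radius_sq_def using real_n by (simp_all add: power_divide power_mult_distrib)

lemma qsphere_Int_L_lattice: "qsphere (P_form n) (P_center n) radius \<inter> L_lattice = (P_vertices :: ((real^'m) \<times> real) set)"
  using L_lattice_outside_sphere(2) P_vertices_on_sphere P_vertices_subset_L_lattice radius_nonneg
  by (auto simp: mem_qsphere radius_square)

lemma P_polytope_eq: "P_polytope = convex hull P_vertices"
  by (simp add: P_polytope_def P_vertices_def)

lemma zero_in_P_vertices: "(0 :: (real^'m) \<times> real) \<in> P_vertices"
  unfolding P_vertices_def layer_b_eq by (auto intro!: exI[of _ "{}"] simp: cube_point_simps(1))

lemma circumscribing_sphere_P:
  "circumscribing_sphere (P_form n) L_lattice (P_polytope :: ((real^'m) \<times> real) set) (P_center n) radius"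
  unfolding circumscribing_sphere_def empty_sphere_def qsphere_Int_L_lattice
proof (intro conjI ballI)
  show "P_polytope = convex hull P_vertices" by (rule P_polytope_eq)
  have "aff_dim (P_vertices :: ((real^'m) \<times> real) set) = int (dim (P_vertices :: ((real^'m) \<times> real) set))"
    by (rule aff_dim_zero) (simp add: zero_in_P_vertices hull_inc)
  also have "dim (P_vertices :: ((real^'m) \<times> real) set) = DIM((real^'m) \<times> real)"
    using span_P_vertices[OF card_ge] by (metis dim_UNIV dim_span)
  finally show "aff_dim (P_vertices :: ((real^'m) \<times> real) set) = int DIM((real^'m) \<times> real)" .
  fix v :: "(real^'m) \<times> real" assume "v \<in> L_lattice"
  then have "radius\<^sup>2 \<le> P_form n (v - P_center n)"
    using L_lattice_outside_sphere(1) by (simp add: radius_square)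
  then show "radius \<le> qnorm (P_form n) (v - P_center n)"
    unfolding qnorm_def by (rule real_le_rsqrt)
qed

lemma polytope_vertices_P: "polytope_vertices P_polytope = (P_vertices :: ((real^'m) \<times> real) set)"
  using circumscribing_sphere_vertices[OF pos_def_form circumscribing_sphere_P]
  by (simp add: qsphere_Int_L_lattice)

text \<open>Subtracting the equation at the vertex 0 removes the quadratic terms and leaves a linear
  functional that vanishes on the spanning set of vertices. This yields both the uniqueness of the
  sphere and the fixed point of all isometries.\<close>

lemma equidistant_imp_center:
  assumes "\<And>v. v \<in> P_vertices \<Longrightarrow> P_form n (v - c :: (real^'m) \<times> real) = \<rho>"
  shows "c = P_center n"
proof -
  let ?d = "P_center n - c"
  have eq: "P_inner n v ?d = 0" if v: "v \<in> P_vertices" for v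
  proof -
    have "P_form n (v - c) - P_form n (v - P_center n) = P_form n (0 - c) - P_form n (0 - P_center n :: (real^'m) \<times> real)"
      using assms[OF v] assms[OF zero_in_P_vertices] P_vertices_on_sphere[OF v]
        P_vertices_on_sphere[OF zero_in_P_vertices] by linarith
    then show ?thesis
      unfolding form_diff by (simp add: bilinear_simps)
  qed
  have "linear (\<lambda>v. P_inner n v ?d)" using bilinear unfolding bilinear_def by blast
  then have "P_inner n v ?d = 0" for v
    using linear_eq_0_on_span[of "\<lambda>v. P_inner n v ?d" P_vertices v] eq
    by (simp add: span_P_vertices[OF card_ge])
  then have "?d = 0" by (intro eq_0_if_orthogonal) (simp add: sym)
  then show ?thesis by simp
qed

lemma circumscribing_sphere_P_iff:
  "circumscribing_sphere (P_form n) L_lattice (P_polytope :: ((real^'m) \<times> real) set) c r \<longleftrightarrow>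
     c = P_center n \<and> r = radius"
proof
  assume S: "circumscribing_sphere (P_form n) L_lattice P_polytope c r"
  have "P_vertices = qsphere (P_form n) c r \<inter> L_lattice"
    using circumscribing_sphere_vertices[OF pos_def_form S] polytope_vertices_P by simp
  then have v: "r \<ge> 0 \<and> P_form n (v - c) = r\<^sup>2" if "v \<in> P_vertices" for v
    using that by (auto simp: mem_qsphere)
  then have c: "c = P_center n" by (intro equidistant_imp_center) blast
  then have "r \<ge> 0" "r\<^sup>2 = radius\<^sup>2"
    using v[OF zero_in_P_vertices] P_vertices_on_sphere[OF zero_in_P_vertices] by (auto simp: radius_square)
  then show "c = P_center n \<and> r = radius" using c radius_nonneg by (simp add: power2_eq_iff_nonneg)
qed (use circumscribing_sphere_P in simp)

lemma delaunay_polytope_P: "delaunay_polytope (P_form n) L_lattice (P_polytope :: ((real^'m) \<times> real) set)"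
  unfolding delaunay_polytope_def
  using pos_def_form full_lattice_L_lattice circumscribing_sphere_P by blast

section \<open>Uniqueness of the form and extremality\<close>

lemma positive_multiple_of_P_form:
  assumes "definite_form q B" "\<And>v. v \<in> P_vertices \<Longrightarrow> q (v - c :: (real^'m) \<times> real) = \<rho>"
  obtains k where "k > 0" "\<And>x. q x = k * P_form n x"
proof -
  interpret q: definite_form q B by fact
  obtain k where k: "\<And>x. B x x = k * P_form n x"
    using P_form_determined[OF q.bilinear q.sym card_ge n_eq] assms(2) q.diag by metis
  have "q (0, 1) > 0" by (rule q.pos) (simp add: zero_prod_def)
  moreover have "P_form n (0 :: real^'m, 1) > 0" by (rule pos) (simp add: zero_prod_def)
  ultimately have "k > 0" using k q.diag by (metis zero_less_mult_pos2)
  then show ?thesis using that k q.diag by simp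
qed

lemma definite_form_scale: 
  assumes "k > 0"
  shows "definite_form (\<lambda>x :: (real^'m) \<times> real. k * P_form n x) (\<lambda>x y. k * P_inner n x y)"
proof
  show "bilinear (\<lambda>x y :: (real^'m) \<times> real. k * P_inner n x y)" by (rule bilinear_scale[OF bilinear])
  show "k * P_inner n x y = k * P_inner n y x" for x y :: "(real^'m) \<times> real" by (simp only: sym)
  show "k * P_form n x = k * P_inner n x x" for x :: "(real^'m) \<times> real" by (simp only: diag)
  show "k * P_form n x > 0" if "x \<noteq> 0" for x :: "(real^'m) \<times> real" using assms pos[OF that] by simp
qed

text \<open>The precise sense in which \<open>P_form\<close> corresponds to the polytope: for the
  given lattice the form is determined up to a positive factor. A factor \<open>k\<close> rescales
  the radius by \<open>sqrt k\<close> and leaves the sphere unchanged as a set.\<close>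

lemma delaunay_polytope_P_iff:
  "delaunay_polytope q L_lattice (P_polytope :: ((real^'m) \<times> real) set) \<longleftrightarrow> (\<exists>k>0. q = (\<lambda>x. k * P_form n x))"
proof
  assume "delaunay_polytope q L_lattice (P_polytope :: ((real^'m) \<times> real) set)"
  then obtain c r where q: "pos_def_form q" and S: "circumscribing_sphere q L_lattice (P_polytope :: ((real^'m) \<times> real) set) c r"
    unfolding delaunay_polytope_def by blast
  obtain B where B: "definite_form q B" using pos_def_form_imp_definite_form[OF q] .
  interpret q: definite_form q B by fact
  have "q (v - c) = r\<^sup>2" if "v \<in> P_vertices" for v
    using that circumscribing_sphere_vertices[OF q S] polytope_vertices_P by (auto simp: q.mem_qsphere)
  then obtain k where "k > 0" "\<And>x. q x = k * P_form n x"
    using positive_multiple_of_P_form[OF B] by metis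
  then show "\<exists>k>0. q = (\<lambda>x. k * P_form n x)" by blast
next
  assume "\<exists>k>0. q = (\<lambda>x. k * P_form n x)"
  then obtain k where k: "k > 0" and q: "q = (\<lambda>x. k * P_form n x)" by blast
  have norm: "qnorm q x = sqrt k * qnorm (P_form n) x" for x
    by (simp add: qnorm_def q real_sqrt_mult)
  have sphere: "qsphere q c (sqrt k * r) = qsphere (P_form n) c r" for c r
    unfolding qsphere_def norm using k by simp
  have "circumscribing_sphere q L_lattice (P_polytope :: ((real^'m) \<times> real) set) (P_center n) (sqrt k * radius)"
    using circumscribing_sphere_P k
    unfolding circumscribing_sphere_def empty_sphere_def sphere by (simp add: norm)
  moreover have "pos_def_form q"
    unfolding q by (rule definite_form.pos_def_form[OF definite_form_scale[OF k]])
  ultimately show "delaunay_polytope q L_lattice (P_polytope :: ((real^'m) \<times> real) set)"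
    unfolding delaunay_polytope_def using full_lattice_L_lattice by blast
qed

lemma extreme_delaunay_polytope_P:
  "extreme_delaunay_polytope (P_form n) L_lattice (P_polytope :: ((real^'m) \<times> real) set)"
  unfolding extreme_delaunay_polytope_def
proof (intro conjI allI impI)
  show "delaunay_polytope (P_form n) L_lattice (P_polytope :: ((real^'m) \<times> real) set)"
    by (rule delaunay_polytope_P)
  fix f :: "(real^'m) \<times> real \<Rightarrow> (real^'m) \<times> real"
  assume f: "affine_bijection f \<and> (\<exists>L'. delaunay_polytope (P_form n) L' (f ` P_polytope))"
  then obtain L' c r where S: "circumscribing_sphere (P_form n) L' (f ` P_polytope) c r"
    unfolding delaunay_polytope_def by blast
  obtain A b where bij: "bij f" and A: "linear A" and f_eq: "f = (\<lambda>x. A x + b)"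
    using f unfolding affine_bijection_def by blast
  have inj: "inj A"
  proof (rule injI)
    fix x y assume "A x = A y"
    then have "f x = f y" by (simp add: f_eq)
    then show "x = y" using bij by (simp add: bij_def inj_eq)
  qed
  have surj: "surj A" using linear_injective_imp_surjective[OF A inj] by simp
  have onto: "P_form n (f v - c) = r\<^sup>2" if "v \<in> P_vertices" for v
  proof -
    have "f v \<in> f ` polytope_vertices P_polytope" using that polytope_vertices_P by simp
    then have "f v \<in> polytope_vertices (f ` P_polytope)"
      unfolding f_eq by (simp add: polytope_vertices_affine_image[OF A inj])
    then show ?thesis
      using circumscribing_sphere_vertices[OF pos_def_form S] by (auto simp: mem_qsphere)
  qed
  \<comment> \<open>The preimage of the new center under \<open>f\<close>, hence the center of the
    pulled-back quadric.\<close>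
  obtain c' where c': "c - b = A c'" using surj by (metis surjD)
  have q': "definite_form (\<lambda>x. P_form n (A x)) (\<lambda>x y. P_inner n (A x) (A y))"
  proof
    show "bilinear (\<lambda>x y. P_inner n (A x) (A y))"
      using bilinear A linear_compose[OF A] unfolding bilinear_def o_def by blast
    fix x y :: "(real^'m) \<times> real"
    show "P_inner n (A x) (A y) = P_inner n (A y) (A x)" by (rule sym)
    show "P_form n (A x) = P_inner n (A x) (A x)" by (rule diag)
    assume "x \<noteq> 0"
    then have "A x \<noteq> 0" using inj A by (metis linear_0 inj_eq)
    then show "P_form n (A x) > 0" by (rule pos)
  qed
  have "P_form n (A (v - c')) = r\<^sup>2" if "v \<in> P_vertices" for v
  proof -
    have "A (v - c') = f v - c" unfolding linear_diff[OF A] c'[symmetric] f_eq by simp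
    then show ?thesis using onto[OF that] by simp
  qed
  then obtain k where k: "k > 0" and scale: "\<And>x. P_form n (A x) = k * P_form n x"
    using positive_multiple_of_P_form[OF q'] by metis
  \<comment> \<open>The homothety is taken about the origin and absorbs the scale
    \<open>sqrt k\<close>; the translation part of \<open>f\<close> goes into
    \<open>g\<close>.\<close>
  define h :: "(real^'m) \<times> real \<Rightarrow> (real^'m) \<times> real" where "h x = 0 + sqrt k *\<^sub>R (x - 0)" for x
  define g where "g x = f ((1 / sqrt k) *\<^sub>R x)" for x
  have "homothety h" unfolding homothety_def h_def using k by (intro exI[of _ 0] exI[of _ "sqrt k"]) auto
  moreover have "f = g \<circ> h" using k by (auto simp: g_def h_def)
  moreover have "isometry_between (P_form n) (P_form n) g"
    unfolding isometry_between_def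
  proof (intro conjI allI)
    have "bij (\<lambda>x :: (real^'m) \<times> real. (1 / sqrt k) *\<^sub>R x)"
      using k by (intro o_bij[where g = "\<lambda>x. sqrt k *\<^sub>R x"]) auto
    then show "bij g" using bij bij_comp[of _ f] unfolding g_def o_def by blast
    fix x y
    have "g x - g y = A ((1 / sqrt k) *\<^sub>R (x - y))"
      by (simp add: g_def f_eq linear_diff[OF A] scaleR_diff_right)
    then have "P_form n (g x - g y) = k * ((1 / sqrt k)\<^sup>2 * P_form n (x - y))"
      by (simp only: scale form_scaleR)
    also have "\<dots> = P_form n (x - y)" using k by (simp add: power_divide)
    finally show "qnorm (P_form n) (g x - g y) = qnorm (P_form n) (x - y)"
      by (simp add: qnorm_def)
  qed
  ultimately show "\<exists>g h. isometry_between (P_form n) (P_form n) g \<and> homothety h \<and> f = g \<circ> h" by blast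
qed

end

section \<open>The stabilizer of the apex\<close>

lemma even_card_sym_diff:
  assumes "finite A" "finite B"
  shows "even (card (sym_diff A B)) \<longleftrightarrow> (even (card A) \<longleftrightarrow> even (card B))"
proof -
  have "card (sym_diff A B) = card (A - B) + card (B - A)"
    using assms by (intro card_Un_disjoint) auto
  moreover have "card A = card (A - B) + card (A \<inter> B)" "card B = card (B - A) + card (A \<inter> B)"
    using assms card_Int_Diff[of A B] card_Int_Diff[of B A] by (simp_all add: Int_commute)
  ultimately show ?thesis by presburger
qed

text \<open>Relative to \<open>half_vec\<close> this is a signed permutation of the coordinates; \<open>r\<close> is the inverse of the
  map that moves the coordinates, so composition reverses the order of the second argument.\<close>

definition signed_perm :: "'m set \<Rightarrow> ('m \<Rightarrow> 'm) \<Rightarrow> (real^'m) \<times> real \<Rightarrow> (real^'m) \<times> real" where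
  "signed_perm A r v = (\<chi> i. if i \<in> A then 1 - fst v $ r i else fst v $ r i, snd v)"

lemma snd_signed_perm [simp]: "snd (signed_perm A r v) = snd v"
  by (simp add: signed_perm_def)

lemma signed_perm_comp: "signed_perm A r (signed_perm B s v) = signed_perm (sym_diff A (r -` B)) (s \<circ> r) v"
  by (auto simp: signed_perm_def vec_eq_iff)

lemma signed_perm_id [simp]: "signed_perm {} id = id"
  by (auto simp: signed_perm_def fun_eq_iff vec_eq_iff)

lemma signed_perm_inverse:
  assumes "bij r"
  shows "signed_perm A r (signed_perm (r ` A) (inv_into UNIV r) v) = v"
    and "signed_perm (r ` A) (inv_into UNIV r) (signed_perm A r v) = v"
proof -
  have r: "inj r" "surj r" using assms by (auto simp: bij_def)
  have "inv_into UNIV r \<circ> r = id" "r \<circ> inv_into UNIV r = id"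
    using r by (auto simp: surj_iff inj_iff)
  moreover have "r -` (r ` A) = A" using r by (simp add: inj_vimage_image_eq)
  moreover have "inv_into UNIV r -` A = r ` A" using assms by (simp add: bij_vimage_eq_inv_image bij_imp_bij_inv inv_inv_eq)
  ultimately show "signed_perm A r (signed_perm (r ` A) (inv_into UNIV r) v) = v"
    "signed_perm (r ` A) (inv_into UNIV r) (signed_perm A r v) = v"
    unfolding signed_perm_comp by simp_all
qed

lemma signed_perm_cube_point:
  "signed_perm A r (cube_point B) = cube_point (sym_diff A (r -` B))"
  by (auto simp: signed_perm_def cube_point_def vec_eq_iff)

lemma cube_point_eq_iff: "cube_point A = cube_point B \<longleftrightarrow> A = B"
  by (auto simp: cube_point_def vec_eq_iff)

text \<open>The image of 0 reveals the set of sign changes; the images of the one-element cube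
  points then reveal the permutation.\<close>

lemma signed_perm_eq_iff: "signed_perm A r = signed_perm B s \<longleftrightarrow> A = B \<and> r = s"
proof
  assume eq: "signed_perm A r = signed_perm B s"
  have "signed_perm A r (cube_point {}) = signed_perm B s (cube_point {})" using eq by simp
  then have AB: "A = B" by (simp add: signed_perm_cube_point cube_point_eq_iff)
  have "r i = s i" for i
  proof -
    have "signed_perm A r (cube_point {r i}) = signed_perm A s (cube_point {r i})"
      using eq AB by simp
    then have "sym_diff A (r -` {r i}) = sym_diff A (s -` {r i})"
      by (simp only: signed_perm_cube_point cube_point_eq_iff)
    then have "i \<in> sym_diff A (r -` {r i}) \<longleftrightarrow> i \<in> sym_diff A (s -` {r i})" by simp
    then show ?thesis by auto
  qed
  with AB show "A = B \<and> r = s" by auto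
qed simp

lemma layer_snd:
  "v \<in> layer_a \<Longrightarrow> snd v = 1" "v \<in> layer_b \<Longrightarrow> snd v = 0" "v \<in> layer_c \<Longrightarrow> snd v = - 1"
  by (auto simp: layer_a_def layer_b_def layer_c_def)

lemma P_vertices_layers:
  "v \<in> P_vertices \<Longrightarrow> snd v = 1 \<Longrightarrow> v \<in> layer_a"
  "v \<in> P_vertices \<Longrightarrow> snd v = 0 \<Longrightarrow> v \<in> layer_b"
  "v \<in> P_vertices \<Longrightarrow> snd v = - 1 \<Longrightarrow> v \<in> layer_c"
  unfolding P_vertices_def using layer_snd by fastforce+

lemma signed_perm_layer_a: "signed_perm A r (half_point + (0, 1)) = half_point + (0, 1)"
  by (simp add: signed_perm_def half_vec_def vec_eq_iff)

lemma signed_perm_layer_c: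
  assumes "bij r"
  shows "signed_perm A r (half_point - (0, 1) + s *\<^sub>R unit_vec (r j))
    = half_point - (0, 1) + (if j \<in> A then - s else s) *\<^sub>R unit_vec j"
proof -
  have "r i = r j \<longleftrightarrow> i = j" for i using assms by (simp add: bij_def inj_eq)
  then show ?thesis by (auto simp: signed_perm_def half_vec_def vec_eq_iff axis_def)
qed

lemma signed_perm_P_vertices:
  fixes r :: "'m::finite \<Rightarrow> 'm"
  assumes r: "bij r" and A: "even (card A)"
  shows "signed_perm A r ` P_vertices = P_vertices"
proof -
  \<comment> \<open>Stated for all \<open>A\<close> and \<open>r\<close>, since the reverse
    inclusion applies it to the inverse map.\<close>
  have sub: "signed_perm A r v \<in> P_vertices" if v: "v \<in> P_vertices" and r: "bij r" and A: "even (card A)"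
    for v and A :: "'m set" and r
  proof -
    consider "v \<in> layer_a" | "v \<in> layer_b" | "v \<in> layer_c"
      using v unfolding P_vertices_def by blast
    then show ?thesis
    proof cases
      case 1
      then show ?thesis by (simp add: layer_a_eq signed_perm_layer_a P_vertices_def del: add_Pair)
    next
      case 2
      then obtain B where B: "v = cube_point B" "even (card B)" unfolding layer_b_eq by blast
      have "card (r -` B) = card B"
        using r by (simp add: card_vimage_inj bij_def)
      then have "even (card (sym_diff A (r -` B)))"
        using A B by (subst even_card_sym_diff) auto
      then show ?thesis
        unfolding B signed_perm_cube_point P_vertices_def layer_b_eq by blast
    next
      case 3
      then obtain s k where s: "s \<in> {1, - 1}" and v: "v = half_point - (0, 1) + s *\<^sub>R unit_vec k"
        unfolding layer_c_eq by blast
      obtain j where "k = r j" using r by (metis bij_pointE)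
      then have "signed_perm A r v = half_point - (0, 1) + (if j \<in> A then - s else s) *\<^sub>R unit_vec j"
        unfolding v by (simp only: signed_perm_layer_c[OF r])
      moreover have "(if j \<in> A then - s else s) \<in> {1, - 1}" using s by auto
      ultimately show ?thesis unfolding P_vertices_def layer_c_eq by blast
    qed
  qed
  show ?thesis
  proof
    show "signed_perm A r ` P_vertices \<subseteq> P_vertices" using sub[OF _ r A] by blast
    show "P_vertices \<subseteq> signed_perm A r ` P_vertices"
    proof
      fix v :: "(real^'m) \<times> real" assume v: "v \<in> P_vertices"
      have "even (card (r ` A))" using r A by (simp add: card_image bij_is_inj inj_on_subset[of r UNIV])
      then have "signed_perm (r ` A) (inv_into UNIV r) v \<in> P_vertices"
        by (intro sub v bij_imp_bij_inv r)
      then show "v \<in> signed_perm A r ` P_vertices"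
        using signed_perm_inverse(1)[OF r] by (metis image_eqI)
    qed
  qed
qed

lemma layer_b_transitive:
  assumes "x \<in> layer_b" "y \<in> (layer_b :: ((real^'m::finite) \<times> real) set)"
  obtains A where "even (card A)" "signed_perm A id x = y"
proof -
  obtain B C where "x = cube_point B" "even (card B)" "y = cube_point C" "even (card C)"
    using assms unfolding layer_b_eq by blast
  then show ?thesis
    by (intro that[of "sym_diff C B"])
      (auto simp: even_card_sym_diff signed_perm_cube_point cube_point_eq_iff)
qed

lemma layer_c_transitive:
  assumes "x \<in> layer_c" "y \<in> (layer_c :: ((real^'m::finite) \<times> real) set)" "CARD('m) \<ge> 2"
  obtains A r where "even (card A)" "bij r" "signed_perm A r x = y"
proof -
  obtain s j where s: "s \<in> {1, - 1}" and x: "x = half_point - (0, 1) + s *\<^sub>R unit_vec j"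
    using assms unfolding layer_c_eq by blast
  obtain s' k where s': "s' \<in> {1, - 1}" and y: "y = half_point - (0, 1) + s' *\<^sub>R unit_vec k"
    using assms unfolding layer_c_eq by blast
  have "card (UNIV - {k}) > 0" using assms(3) by (simp add: card_Diff_singleton)
  then have "UNIV - {k} \<noteq> {}" by (metis card.empty less_irrefl)
  then obtain l where l: "l \<noteq> k" by auto
  \<comment> \<open>A sign change needed at \<open>k\<close> is paired with one at \<open>l\<close>
    to keep the number even; the second is harmless, because the entry at \<open>l\<close> is
    1/2.\<close>
  define A where "A = (if s = s' then {} else {k, l})"
  define r where "r = Transposition.transpose j k"
  have r: "bij r" "r k = j" by (simp_all add: r_def)
  have "even (card A)" using l by (simp add: A_def)
  moreover have "(if k \<in> A then - s else s) = s'" using s s' l by (auto simp: A_def)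
  then have "signed_perm A r x = y"
    using signed_perm_layer_c[OF r(1), of A s k] unfolding x y r(2) by simp
  ultimately show ?thesis using that r(1) by blast
qed

section \<open>Isometries of the polytope and the stabilizer of the apex\<close>

lemma P_inner_unit_vec:
  "P_inner n (unit_vec i) (unit_vec j :: (real^'m::finite) \<times> real) = (if i = j then 1 else 0)"
  by (auto simp: P_inner_def axis_def if_distrib[of "\<lambda>x. x * _"] cong: if_cong)

lemma isometry_group_comp:
  fixes P :: "'a::real_vector set"
  assumes "f \<in> carrier (isometry_group q P)" "g \<in> carrier (isometry_group q P)"
  shows "f \<circ> g \<in> carrier (isometry_group q P)"
proof -
  have "(f \<circ> g) ` P = f ` g ` P" by (rule image_comp[symmetric])
  then show ?thesis
    using assms unfolding isometry_group_def isometry_between_def by (simp add: bij_comp)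
qed

lemma isometry_group_inv:
  fixes P :: "'a::real_vector set"
  assumes "f \<in> carrier (isometry_group q P)"
  shows "inv_into UNIV f \<in> carrier (isometry_group q P)"
proof -
  have f: "bij f" "f ` P = P" and d: "\<And>x y. qnorm q (f x - f y) = qnorm q (x - y)"
    using assms unfolding isometry_group_def isometry_between_def by auto
  have "qnorm q (inv_into UNIV f x - inv_into UNIV f y) = qnorm q (x - y)" for x y
    using d[of "inv_into UNIV f x" "inv_into UNIV f y"] f(1) by (simp add: surj_f_inv_f bij_is_surj)
  moreover have "inv_into UNIV f ` P = P"
    using f by (metis bij_is_inj image_inv_f_f)
  ultimately show ?thesis
    unfolding isometry_group_def isometry_between_def using f(1) by (simp add: bij_imp_bij_inv)
qed

context P_setting
begin

abbreviation P_isometries :: "((real^'m) \<times> real \<Rightarrow> (real^'m) \<times> real) set" where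
  "P_isometries \<equiv> carrier (isometry_group (P_form n) P_polytope)"

abbreviation apex :: "(real^'m) \<times> real" where
  "apex \<equiv> half_point + (0, 1)"

text \<open>An isometry is affine and injective, so it commutes with convex hulls and with taking
  extreme points.\<close>

lemma P_isometries_iff:
  "f \<in> P_isometries \<longleftrightarrow> isometry_between (P_form n) (P_form n) f \<and> f ` P_vertices = P_vertices"
proof -
  have "f ` P_polytope = P_polytope \<longleftrightarrow> f ` P_vertices = P_vertices"
    if iso: "isometry_between (P_form n) (P_form n) f"
  proof -
    obtain A where A: "linear A" "\<And>x y. P_inner n (A x) (A y) = P_inner n x y"
      and f: "\<And>x z. f x = f z + A (x - z)"
      using isometry_affine[OF iso] by blast
    have "f x = A x + f 0" for x using f[of x 0] by simp
    then have f': "f = (\<lambda>x. A x + f 0)" by (rule ext)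
    have inj: "inj A"
    proof (rule injI)
      fix x y assume "A x = A y"
      then have "P_form n (x - y) = 0"
        using A(2)[of "x - y" "x - y"] by (simp add: diag linear_diff[OF A(1)] bilinear_simps)
      then show "x = y" by simp
    qed
    have "f ` P_vertices = polytope_vertices (f ` P_polytope)"
      using polytope_vertices_affine_image[OF A(1) inj, of "f 0" P_polytope]
      unfolding f'[symmetric] polytope_vertices_P by simp
    moreover have "f ` P_polytope = convex hull (f ` P_vertices)"
      using convex_hull_affine_image[OF A(1), of "f 0" P_vertices]
      unfolding f'[symmetric] P_polytope_eq .
    ultimately show ?thesis using polytope_vertices_P P_polytope_eq by metis
  qed
  then show ?thesis unfolding isometry_group_def by auto
qed

lemma P_isometries_dist:
  "f \<in> P_isometries \<Longrightarrow> P_form n (f x - f y) = P_form n (x - y)"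
  unfolding P_isometries_iff isometry_between_def qnorm_eq_iff by blast

lemma P_isometries_vertex: "f \<in> P_isometries \<Longrightarrow> v \<in> P_vertices \<Longrightarrow> f v \<in> P_vertices"
  unfolding P_isometries_iff by blast

lemma P_isometries_center:
  assumes f: "f \<in> P_isometries"
  shows "f (P_center n) = P_center n"
proof (rule equidistant_imp_center)
  fix v :: "(real^'m) \<times> real" assume "v \<in> P_vertices"
  then obtain w where "w \<in> P_vertices" "v = f w" using f unfolding P_isometries_iff by blast
  then show "P_form n (v - f (P_center n)) = radius_sq"
    using P_isometries_dist[OF f] P_vertices_on_sphere by simp
qed

lemma signed_perm_isometry:
  assumes r: "bij r" and A: "even (card A)"
  shows "signed_perm A r \<in> P_isometries"
  unfolding P_isometries_iff isometry_between_def
proof (intro conjI allI)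
  show "bij (signed_perm A r :: (real^'m) \<times> real \<Rightarrow> _)"
    using signed_perm_inverse[OF r]
    by (intro o_bij[where g = "signed_perm (r ` A) (inv_into UNIV r)"]) auto
  show "signed_perm A r ` P_vertices = P_vertices" by (rule signed_perm_P_vertices[OF r A])
  fix x y :: "(real^'m) \<times> real"
  have "(fst (signed_perm A r x - signed_perm A r y) $ i)\<^sup>2 = (fst (x - y) $ r i)\<^sup>2" for i
    by (simp add: signed_perm_def power2_commute)
  then have "(\<Sum>i\<in>UNIV. (fst (signed_perm A r x - signed_perm A r y) $ i)\<^sup>2) = (\<Sum>i\<in>UNIV. (fst (x - y) $ r i)\<^sup>2)"
    by simp
  also have "\<dots> = (\<Sum>i\<in>UNIV. (fst (x - y) $ i)\<^sup>2)"
    using r by (rule sum.reindex_bij_betw)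
  finally show "qnorm (P_form n) (signed_perm A r x - signed_perm A r y) = qnorm (P_form n) (x - y)"
    unfolding qnorm_def P_form_def by simp
qed

lemma apex_stabilizer:
  assumes f: "f \<in> P_isometries" and apex: "f apex = apex"
  obtains A r where "even (card A)" "bij r" "f = signed_perm A r"
proof -
  have iso: "isometry_between (P_form n) (P_form n) f"
    using f unfolding isometry_group_def by simp
  obtain L where L: "linear L" and inner: "\<And>x y. P_inner n (L x) (L y) = P_inner n x y"
    and f_eq: "\<And>x z. f x = f z + L (x - z)"
    using isometry_affine[OF iso] by blast
  let ?T = "(0, 1) :: (real^'m) \<times> real"
  let ?c = "P_center n :: (real^'m) \<times> real"
  have N: "real n - 3 > 0" using real_n by simp
  \<comment> \<open>The apex, the center and \<open>half_point\<close> lie on one vertical line, so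
    fixing the apex and the center fixes the direction of this line and with it
    \<open>half_point\<close>.\<close>
  have LT: "L ?T = ?T"
  proof -
    define k where "k = 1 + 1 / (real n - 3)"
    have k: "k \<noteq> 0" using N divide_pos_pos[of 1 "real n - 3"] unfolding k_def by linarith
    have V: "apex - ?c = k *\<^sub>R ?T" by (simp add: P_center_def k_def prod_eq_iff)
    have "L (apex - ?c) = apex - ?c"
      using f_eq[of apex ?c] apex P_isometries_center[OF f] by (simp add: algebra_simps)
    then show ?thesis unfolding V linear_scale[OF L] using scaleR_left_imp_eq[OF k] by blast
  qed
  have fh: "f half_point = half_point"
  proof -
    have V: "half_point - ?c = (1 / (real n - 3)) *\<^sub>R ?T" by (simp add: P_center_def prod_eq_iff)
    have "L (half_point - ?c) = half_point - ?c" unfolding V linear_scale[OF L] LT ..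
    then show ?thesis using f_eq[of half_point ?c] P_isometries_center[OF f] by simp
  qed
  have sndL: "snd (L x) = snd x" for x
    using inner[of x ?T] N unfolding LT by (simp add: P_inner_def)
  have "\<exists>s k. s \<in> {1, - 1} \<and> L (unit_vec j) = s *\<^sub>R unit_vec k" for j
  proof -
    let ?v = "half_point - ?T + unit_vec j"
    have "half_point - ?T + 1 *\<^sub>R unit_vec j \<in> P_vertices"
      unfolding P_vertices_def layer_c_eq by blast
    then have "?v \<in> P_vertices" by (simp only: scaleR_one)
    then have "f ?v \<in> P_vertices" by (rule P_isometries_vertex[OF f])
    moreover have fv: "f ?v = half_point - ?T + L (unit_vec j)"
    proof -
      have e: "?v - half_point = unit_vec j - ?T" by simp
      have "f ?v = f half_point + L (?v - half_point)" by (rule f_eq)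
      also have "\<dots> = half_point + (L (unit_vec j) - ?T)"
        unfolding fh e linear_diff[OF L] LT ..
      finally show ?thesis by (simp only: add_diff_eq diff_add_eq)
    qed
    moreover have "snd (f ?v) = - 1" unfolding fv by (simp add: sndL)
    ultimately have "f ?v \<in> layer_c"
      by (simp only: P_vertices_layers)
    then obtain s k where "s \<in> {1, - 1}" "half_point - ?T + L (unit_vec j) = half_point - ?T + s *\<^sub>R unit_vec k"
      unfolding fv layer_c_eq by blast
    then show ?thesis using add_left_cancel by blast
  qed
  then obtain s p where s: "\<And>j. s j \<in> {1, - 1 :: real}"
    and Lu: "\<And>j. L (unit_vec j) = s j *\<^sub>R unit_vec (p j)" by metis
  have "inj p"
  proof (rule injI, rule ccontr)
    fix i j assume p: "p i = p j" and "i \<noteq> j"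
    then have "P_inner n (L (unit_vec i)) (L (unit_vec j)) = 0"
      unfolding inner by (simp add: P_inner_unit_vec)
    then have "s i * s j * P_inner n (unit_vec (p j) :: (real^'m) \<times> real) (unit_vec (p j)) = 0"
      unfolding Lu p bilinear_simps by auto
    then show False unfolding P_inner_unit_vec using s[of i] s[of j] by auto
  qed
  then have p: "bij p" by (simp add: bij_def finite_UNIV_inj_surj)
  define r where "r = inv_into UNIV p"
  have r: "bij r" unfolding r_def using p by (rule bij_imp_bij_inv)
  have pr: "i = p j \<longleftrightarrow> j = r i" for i j unfolding r_def using p by (metis bij_inv_eq_iff)
  define A where "A = {i. s (r i) = - 1}"
  have f_sp: "f x = signed_perm A r x" for x
  proof -
    have x: "x - half_point = (\<Sum>j\<in>UNIV. (fst x $ j - 1/2) *\<^sub>R unit_vec j) + snd x *\<^sub>R ?T"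
      by (auto simp: prod_eq_iff fst_sum snd_sum vec_eq_iff half_vec_def axis_def
          if_distrib[of "\<lambda>x. _ * x"] cong: if_cong)
    have "L (x - half_point) = (\<Sum>j\<in>UNIV. (fst x $ j - 1/2) *\<^sub>R s j *\<^sub>R unit_vec (p j)) + snd x *\<^sub>R ?T"
      unfolding x linear_add[OF L] linear_sum[OF L] linear_scale[OF L] Lu LT ..
    then have "fst (L (x - half_point)) $ i = (fst x $ r i - 1/2) * s (r i)" for i
      by (simp add: fst_sum axis_def pr if_distrib[of "\<lambda>x. _ * x"] cong: if_cong)
    moreover have "f x = half_point + L (x - half_point)" using f_eq[of x half_point] fh by simp
    ultimately have "fst (f x) $ i = 1/2 + (fst x $ r i - 1/2) * s (r i)" "snd (f x) = snd x" for i
      by (simp_all add: half_vec_def sndL)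
    moreover have "1/2 + (fst x $ r i - 1/2) * s (r i) = (if i \<in> A then 1 - fst x $ r i else fst x $ r i)" for i
      using s[of "r i"] by (auto simp: A_def)
    ultimately show ?thesis by (simp add: signed_perm_def prod_eq_iff vec_eq_iff)
  qed
  have "f (cube_point {}) \<in> P_vertices"
    using P_isometries_vertex[OF f zero_in_P_vertices] by (simp add: cube_point_simps)
  then have "cube_point A \<in> P_vertices"
    unfolding f_sp signed_perm_cube_point by simp
  moreover have "snd (cube_point A) = 0" by (simp add: cube_point_def)
  ultimately have "cube_point A \<in> layer_b" by (simp only: P_vertices_layers)
  then have "even (card A)" unfolding layer_b_eq by (auto simp: cube_point_eq_iff)
  then show ?thesis using r f_sp that by blast
qed

lemma apex_stabilizer_eq:
  "{f \<in> P_isometries. f apex = apex} = {signed_perm A r | A r. even (card A) \<and> bij r}"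
proof (intro equalityI subsetI)
  fix f assume "f \<in> {f \<in> P_isometries. f apex = apex}"
  then show "f \<in> {signed_perm A r | A r. even (card A) \<and> bij r}"
    using apex_stabilizer[of f] by blast
next
  fix f :: "(real^'m) \<times> real \<Rightarrow> _" assume "f \<in> {signed_perm A r | A r. even (card A) \<and> bij r}"
  then obtain A r where "even (card A)" "bij r" "f = signed_perm A r" by blast
  then show "f \<in> {f \<in> P_isometries. f apex = apex}"
    using signed_perm_isometry signed_perm_layer_a by blast
qed

end

section \<open>The isometry group for \<open>n > 6\<close>\<close>

text \<open>The element \<open>x\<close> acts as a parity check: whether it belongs to an even set
  is determined by the rest of the set.\<close>

lemma bij_betw_even_subsets:
  assumes "finite U" "x \<in> U"
  shows "bij_betw (\<lambda>A. A - {x}) {A. A \<subseteq> U \<and> even (card A)} (Pow (U - {x}))"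
proof (rule bij_betwI[where g = "\<lambda>A. if even (card A) then A else insert x A"])
  show "(\<lambda>A. A - {x}) \<in> {A. A \<subseteq> U \<and> even (card A)} \<rightarrow> Pow (U - {x})" by auto
  show "(\<lambda>A. if even (card A) then A else insert x A) \<in> Pow (U - {x}) \<rightarrow> {A. A \<subseteq> U \<and> even (card A)}"
  proof
    fix A assume A: "A \<in> Pow (U - {x})"
    then have "finite A" "x \<notin> A" using assms(1) finite_subset[of A U] by auto
    then show "(if even (card A) then A else insert x A) \<in> {A. A \<subseteq> U \<and> even (card A)}"
      using A assms(2) by auto
  qed
next
  fix A assume A: "A \<in> {A. A \<subseteq> U \<and> even (card A)}"
  then have "finite A" using assms(1) finite_subset by auto
  then show "(if even (card (A - {x})) then A - {x} else insert x (A - {x})) = A"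
    using A by (cases "x \<in> A") (auto simp: insert_absorb card_gt_0_iff)
next
  fix A assume "A \<in> Pow (U - {x})"
  then show "(if even (card A) then A else insert x A) - {x} = A" by auto
qed

lemma card_even_subsets:
  assumes "finite U" "x \<in> U"
  shows "card {A. A \<subseteq> U \<and> even (card A)} = 2 ^ (card U - 1)"
  using bij_betw_same_card[OF bij_betw_even_subsets[OF assms]] assms by (simp add: card_Pow)

text \<open>Parity determines the membership of \<open>Suc k\<close>, so the first \<open>k\<close>
  indices are free. The indicator on {1..k} forgets the last index and turns symmetric difference
  into addition modulo 2.\<close>

lemma even_subset_group_iso:
  "even_subset_group (Suc k) \<cong> elementary_abelian_2_group k"
proof (rule is_isoI)
  let ?ind = "\<lambda>A. \<lambda>i\<in>{1..k}. of_bool (i \<in> A) :: int"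
  have carrier: "carrier (elementary_abelian_2_group k) = (\<Pi>\<^sub>E i\<in>{1..k}. {0..<2})"
    by (simp add: elementary_abelian_2_group_def carrier_integer_mod_group)
  have ind: "bij_betw ?ind (Pow {1..k}) (\<Pi>\<^sub>E i\<in>{1..k}. {0..<2})"
  proof (rule bij_betwI[where g = "\<lambda>f. {i \<in> {1..k}. f i = 1}"])
    fix f :: "nat \<Rightarrow> int" assume f: "f \<in> (\<Pi>\<^sub>E i\<in>{1..k}. {0..<2})"
    show "?ind {i \<in> {1..k}. f i = 1} = f"
    proof (rule extensionalityI[of _ "{1..k}"])
      fix i assume i: "i \<in> {1..k}"
      then have "f i \<in> {0..<2}" using f by blast
      then have "f i = 0 \<or> f i = 1" by auto
      then show "?ind {i \<in> {1..k}. f i = 1} i = f i" using i by auto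
    qed (use f in \<open>auto simp: PiE_def\<close>)
  qed auto
  have "{1..Suc k} - {Suc k} = {1..k}" by auto
  then have "bij_betw (\<lambda>A. A - {Suc k}) {A. A \<subseteq> {1..Suc k} \<and> even (card A)} (Pow {1..k})"
    using bij_betw_even_subsets[of "{1..Suc k}" "Suc k"] by simp
  then have "bij_betw (?ind \<circ> (\<lambda>A. A - {Suc k})) {A. A \<subseteq> {1..Suc k} \<and> even (card A)} (\<Pi>\<^sub>E i\<in>{1..k}. {0..<2})"
    using ind by (rule bij_betw_trans)
  moreover have "?ind \<circ> (\<lambda>A. A - {Suc k}) = ?ind" by (auto simp: fun_eq_iff)
  ultimately have bij: "bij_betw ?ind (carrier (even_subset_group (Suc k))) (carrier (elementary_abelian_2_group k))"
    unfolding carrier by (simp add: even_subset_group_def)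
  moreover have "?ind (A \<otimes>\<^bsub>even_subset_group (Suc k)\<^esub> B) = ?ind A \<otimes>\<^bsub>elementary_abelian_2_group k\<^esub> ?ind B" for A B
    by (auto simp: even_subset_group_def elementary_abelian_2_group_def fun_eq_iff)
  ultimately show "?ind \<in> iso (even_subset_group (Suc k)) (elementary_abelian_2_group k)"
    unfolding iso_def hom_def using bij_betwE by blast
qed

text \<open>Group axioms have not been established for \<open>H\<close> or \<open>G\<close>; closure
  of \<open>H\<close> is what lets the inverse recognize a product of preimages.\<close>

lemma is_iso_if_iso_from:
  assumes "f \<in> iso H G" "\<And>a b. a \<in> carrier H \<Longrightarrow> b \<in> carrier H \<Longrightarrow> a \<otimes>\<^bsub>H\<^esub> b \<in> carrier H"
  shows "G \<cong> H"
proof (rule is_isoI)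
  let ?g = "inv_into (carrier H) f"
  have f: "bij_betw f (carrier H) (carrier G)"
    and hom: "\<And>a b. a \<in> carrier H \<Longrightarrow> b \<in> carrier H \<Longrightarrow> f (a \<otimes>\<^bsub>H\<^esub> b) = f a \<otimes>\<^bsub>G\<^esub> f b"
    using assms(1) unfolding iso_def hom_def by auto
  have g: "bij_betw ?g (carrier G) (carrier H)" using f by (rule bij_betw_inv_into)
  have "?g (x \<otimes>\<^bsub>G\<^esub> y) = ?g x \<otimes>\<^bsub>H\<^esub> ?g y" if x: "x \<in> carrier G" and y: "y \<in> carrier G" for x y
  proof -
    have "?g x \<in> carrier H" "?g y \<in> carrier H" using g x y bij_betwE by blast+
    then have "f (?g x \<otimes>\<^bsub>H\<^esub> ?g y) = x \<otimes>\<^bsub>G\<^esub> y" "?g x \<otimes>\<^bsub>H\<^esub> ?g y \<in> carrier H"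
      using hom assms(2) x y f by (auto simp: bij_betw_inv_into_right)
    then show ?thesis using f by (metis bij_betw_inv_into_left)
  qed
  then show "?g \<in> iso G H" unfolding iso_def hom_def using g bij_betwE by blast
qed

context P_setting
begin

lemma P_form_cube_point_diff:
  "P_form n (cube_point A - cube_point B :: (real^'m) \<times> real) = real (card (sym_diff A B))"
proof -
  define X where "X = sym_diff A B"
  have "(fst (cube_point A - cube_point B :: (real^'m) \<times> real) $ i)\<^sup>2 = of_bool (i \<in> X)" for i
    by (auto simp: cube_point_def X_def)
  then show ?thesis unfolding X_def[symmetric] by (simp add: P_form_def cube_point_def sum.If_cases of_bool_def)
qed

lemma P_form_apex_diff:
  fixes w :: "(real^'m) \<times> real"
  shows "w \<in> layer_a \<Longrightarrow> P_form n (apex - w) = 0"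
    and "w \<in> layer_b \<Longrightarrow> P_form n (apex - w) = (real n - 2) / 2"
    and "w \<in> layer_c \<Longrightarrow> P_form n (apex - w) = real n - 2"
proof -
  show "w \<in> layer_a \<Longrightarrow> P_form n (apex - w) = 0" by (simp add: layer_a_def)
  assume "w \<in> layer_b"
  then obtain A where w: "w = cube_point A" unfolding layer_b_eq by blast
  have "(fst (apex - w) $ i)\<^sup>2 = 1/4" for i
    by (simp add: w half_vec_def cube_point_def power2_eq_square)
  then have "(\<Sum>i\<in>UNIV. (fst (apex - w) $ i)\<^sup>2) = (\<Sum>i\<in>(UNIV :: 'm set). 1/4)"
    by (intro sum.cong refl)
  moreover have "snd (apex - w) = 1" by (simp add: w cube_point_def)
  ultimately show "P_form n (apex - w) = (real n - 2) / 2"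
    using real_card unfolding P_form_def by (simp add: field_simps)
next
  assume "w \<in> layer_c"
  then obtain s j where s: "s \<in> {1, - 1}" and w: "w = half_point - (0, 1) + s *\<^sub>R unit_vec j"
    unfolding layer_c_eq by blast
  have "(fst (apex - w) $ i)\<^sup>2 = (if i = j then 1 else 0)" for i
    using s by (auto simp: w axis_def)
  moreover have "snd (apex - w) = 2" by (simp add: w)
  ultimately show "P_form n (apex - w) = real n - 2"
    by (simp only: P_form_def) (simp add: field_simps)
qed

lemma apex_in_P_vertices: "apex \<in> P_vertices"
  unfolding P_vertices_def layer_a_eq by blast

text \<open>The minimal squared norm of the lattice is \<open>2\<close>; for \<open>n > 6\<close> the apex is the only vertex
  without a neighbour at that distance.\<close>

lemma apex_fixed:
  assumes n: "n > 6" and f: "f \<in> P_isometries"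
  shows "f apex = apex"
proof -
  let ?near = "\<lambda>v :: (real^'m) \<times> real. \<exists>w\<in>P_vertices. P_form n (v - w) = 2"
  \<comment> \<open>The squared distances from the apex are 0, (n - 2)/2 and n - 2, and none of them
    is 2 when n > 6.\<close>
  have no: "\<not> ?near apex"
    using P_form_apex_diff n unfolding P_vertices_def by (fastforce simp del: add_Pair)
  have yes: "?near v" if v: "v \<in> P_vertices" "v \<notin> layer_a" for v :: "(real^'m) \<times> real"
  proof -
    obtain i j k l l' :: 'm where d: "distinct [i, j, k, l, l']" using obtain_distinct_five[OF card_ge] .
    consider "v \<in> layer_b" | "v \<in> layer_c" using v unfolding P_vertices_def by blast
    then show ?thesis
    proof cases
      case 1
      then obtain A where A: "v = cube_point A" "even (card A)" unfolding layer_b_eq by blast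
      let ?B = "sym_diff A {i, j}"
      have "even (card ?B)" using A d by (subst even_card_sym_diff) auto
      then have "cube_point ?B \<in> P_vertices" unfolding P_vertices_def layer_b_eq by blast
      moreover have "sym_diff A ?B = {i, j}" by auto
      ultimately show ?thesis using d by (intro bexI[of _ "cube_point ?B"]) (simp_all add: A P_form_cube_point_diff)
    next
      case 2
      then obtain s k where s: "s \<in> {1, - 1}" and w: "v = half_point - (0, 1) + s *\<^sub>R unit_vec k"
        unfolding layer_c_eq by blast
      obtain l where l: "l \<noteq> k" using d by (metis distinct_length_2_or_more)
      let ?w = "half_point - (0, 1) + s *\<^sub>R unit_vec l"
      have "v - ?w = s *\<^sub>R (unit_vec k - unit_vec l)" unfolding w by (simp add: scaleR_diff_right)
      moreover have "P_form n (unit_vec k - unit_vec l :: (real^'m) \<times> real) = 2"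
        unfolding form_diff unfolding diag P_inner_unit_vec using l by simp
      moreover have "s\<^sup>2 = 1" using s by auto
      ultimately have "P_form n (v - ?w) = 2" by (simp only: form_scaleR mult_1_left)
      moreover have "?w \<in> P_vertices" using s unfolding P_vertices_def layer_c_eq by blast
      ultimately show ?thesis by blast
    qed
  qed
  have "\<not> ?near (f apex)"
  proof
    assume "?near (f apex)"
    then obtain w where w: "w \<in> P_vertices" "P_form n (f apex - w) = 2" by blast
    then obtain u where u: "u \<in> P_vertices" "w = f u" using f unfolding P_isometries_iff by blast
    then have "P_form n (apex - u) = 2" using w P_isometries_dist[OF f, of apex u] by simp
    then show False using no u by blast
  qed
  then have "f apex \<in> layer_a" using yes P_isometries_vertex[OF f apex_in_P_vertices] by blast
  then show ?thesis unfolding layer_a_eq by blast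
qed

lemma P_isometries_eq:
  assumes "n > 6"
  shows "P_isometries = {signed_perm A r | A r. even (card A) \<and> bij r}"
  using apex_stabilizer_eq apex_fixed[OF assms] by blast

section \<open>The three vertex orbits\<close>

lemma orbit_layer_a:
  assumes "n > 6"
  shows "orbit (isometry_group (P_form n) P_polytope) (\<lambda>g. g) apex = layer_a"
proof -
  have "id \<in> P_isometries" unfolding isometry_group_def isometry_between_def by simp
  then have "apex \<in> orbit (isometry_group (P_form n) P_polytope) (\<lambda>g. g) apex"
    unfolding orbit_def using id_apply[of apex] by (metis (mono_tags, lifting) mem_Collect_eq)
  then show ?thesis unfolding orbit_def layer_a_eq using apex_fixed[OF assms] by blast
qed

lemma orbit_layer:
  assumes "n > 6" "x \<in> X"
    and X: "X = layer_b \<or> X = (layer_c :: ((real^'m) \<times> real) set)"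
  shows "orbit (isometry_group (P_form n) P_polytope) (\<lambda>g. g) x = X"
proof
  show "orbit (isometry_group (P_form n) P_polytope) (\<lambda>g. g) x \<subseteq> X"
  proof
    fix y assume "y \<in> orbit (isometry_group (P_form n) P_polytope) (\<lambda>g. g) x"
    then obtain g where g: "g \<in> P_isometries" and y: "y = g x" unfolding orbit_def by blast
    have "y \<in> P_vertices" unfolding y using X assms(2)
      by (intro P_isometries_vertex[OF g]) (auto simp: P_vertices_def)
    moreover obtain A r where "g = signed_perm A r" using g P_isometries_eq[OF assms(1)] by blast
    then have "snd y = snd x" by (simp add: y)
    ultimately show "y \<in> X" using X assms(2) by (metis P_vertices_layers(2,3) layer_snd(2,3))
  qed
  show "X \<subseteq> orbit (isometry_group (P_form n) P_polytope) (\<lambda>g. g) x"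
  proof
    fix y assume y: "y \<in> X"
    have "\<exists>A r. even (card A) \<and> bij r \<and> signed_perm A r x = y"
      using X
    proof
      assume "X = layer_b"
      then show ?thesis using y assms(2) layer_b_transitive[of x y] bij_id by metis
    next
      assume "X = layer_c"
      moreover have "CARD('m) \<ge> 2" using card_ge by simp
      ultimately show ?thesis using y assms(2) layer_c_transitive[of x y] by metis
    qed
    then show "y \<in> orbit (isometry_group (P_form n) P_polytope) (\<lambda>g. g) x"
      unfolding orbit_def using signed_perm_isometry by blast
  qed
qed

lemma layers_nonempty: "layer_b \<noteq> {}" "layer_c \<noteq> {}"
proof -
  have "cube_point {} \<in> layer_b" unfolding layer_b_eq by fastforce
  then show "layer_b \<noteq> {}" by blast
  show "layer_c \<noteq> {}" unfolding layer_c_def by blast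
qed

lemma card_orbits:
  assumes "n > 6"
  shows "card (orbits (isometry_group (P_form n) P_polytope) (polytope_vertices P_polytope :: ((real^'m) \<times> real) set) (\<lambda>g. g)) = 3"
proof -
  let ?orb = "orbit (isometry_group (P_form n) (P_polytope :: ((real^'m) \<times> real) set)) (\<lambda>g. g)"
  have "orbits (isometry_group (P_form n) P_polytope) (P_vertices :: ((real^'m) \<times> real) set) (\<lambda>g. g)
      = ?orb ` layer_a \<union> ?orb ` layer_b \<union> ?orb ` layer_c"
    unfolding orbits_def P_vertices_def by auto
  also have "?orb ` layer_a = {layer_a}" using orbit_layer_a[OF assms] by (simp add: layer_a_eq del: add_Pair)
  also have "?orb ` layer_b = {layer_b}" using orbit_layer[OF assms] layers_nonempty by auto
  also have "?orb ` layer_c = {layer_c}" using orbit_layer[OF assms] layers_nonempty by auto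
  finally have "orbits (isometry_group (P_form n) P_polytope) (P_vertices :: ((real^'m) \<times> real) set) (\<lambda>g. g)
      = {layer_a, layer_b, layer_c}" by auto
  moreover have "layer_a \<noteq> (layer_b :: ((real^'m) \<times> real) set)" "layer_a \<noteq> (layer_c :: ((real^'m) \<times> real) set)"
    "layer_b \<noteq> (layer_c :: ((real^'m) \<times> real) set)"
    using layers_nonempty layer_snd by (metis all_not_in_conv zero_neq_one zero_neq_neg_one one_neq_neg_one)+
  ultimately show ?thesis by (simp add: polytope_vertices_P)
qed

text \<open>The pair \<open>(A, p)\<close> becomes a signed permutation once {1..n - 1} is carried
  to the index type by \<open>h\<close>. A permutation conjugates a set of sign changes into its
  image, which is the action of the semidirect product.\<close>

lemma isometry_group_iso:
  assumes n: "n > 6"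
  shows "isometry_group (P_form n) (P_polytope :: ((real^'m) \<times> real) set) \<cong>
    semidirect_product (even_subset_group (n - 1)) (sym_group (n - 1)) image"
    (is "?G \<cong> ?H")
proof -
  define N where "N = {1..n - 1}"
  have N: "finite N" "card N = CARD('m)" by (simp_all add: N_def card_index)
  obtain h :: "nat \<Rightarrow> 'm" where h: "bij_betw h N UNIV"
    using finite_same_card_bij[OF N(1) finite N(2)] by blast
  define g where "g = inv_into N h"
  have g: "g x \<in> N" "h (g x) = x" for x
    unfolding g_def
    by (rule bij_betw_apply[OF bij_betw_inv_into[OF h] UNIV_I])
      (rule bij_betw_inv_into_right[OF h UNIV_I])
  have gh: "g (h a) = a" if "a \<in> N" for a
    unfolding g_def using h that by (rule bij_betw_inv_into_left)
  have inj: "inj_on h N" using h by (simp add: bij_betw_def)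
  \<comment> \<open>Since \<open>signed_perm\<close> pulls coordinates back and so reverses products
    of permutations, inverting \<open>p\<close> restores the order.\<close>
  define R where "R p x = h (inv_into UNIV p (g x))" for p x
  define \<Phi> :: "nat set \<times> (nat \<Rightarrow> nat) \<Rightarrow> (real^'m) \<times> real \<Rightarrow> (real^'m) \<times> real"
    where "\<Phi> = (\<lambda>(A, p). signed_perm (h ` A) (R p))"
  have carrier: "carrier ?H = {A. A \<subseteq> N \<and> even (card A)} \<times> {p. p permutes N}"
    by (simp add: semidirect_product_def even_subset_group_def sym_group_def N_def)
  have mult: "(A, p) \<otimes>\<^bsub>?H\<^esub> (B, p') = (sym_diff A (p ` B), p \<circ> p')" for A B p p'
    by (simp add: semidirect_product_def even_subset_group_def sym_group_def)
  have inv_N: "inv_into UNIV p a \<in> N" if "p permutes N" "a \<in> N" for p a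
    using that permutes_inv permutes_in_image by metis
  have bijR: "bij (R p)" if p: "p permutes N" for p
  proof (rule o_bij[where g = "\<lambda>x. h (p (g x))"])
    have pN: "p a \<in> N" if "a \<in> N" for a using p that by (simp add: permutes_in_image)
    show "(\<lambda>x. h (p (g x))) \<circ> R p = id"
      using g gh inv_N[OF p] permutes_inverses(1)[OF p] by (simp add: R_def fun_eq_iff)
    show "R p \<circ> (\<lambda>x. h (p (g x))) = id"
      using g gh pN permutes_inverses(2)[OF p] by (simp add: R_def fun_eq_iff)
  qed
  have even: "even (card (h ` A))" if "A \<subseteq> N" "even (card A)" for A
    using that inj by (simp add: card_image inj_on_subset)
  have \<Phi>_hom: "\<Phi> ((A, p) \<otimes>\<^bsub>?H\<^esub> (B, p')) = \<Phi> (A, p) \<circ> \<Phi> (B, p')"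
    if A: "A \<subseteq> N" and p: "p permutes N" and B: "B \<subseteq> N" and p': "p' permutes N" for A B p p'
  proof -
    have pB: "p ` B \<subseteq> N" using B permutes_image[OF p] by blast
    have "R (p \<circ> p') = R p' \<circ> R p"
      using g gh inv_N[OF p] by (auto simp: R_def fun_eq_iff o_inv_distrib permutes_bij[OF p] permutes_bij[OF p'])
    moreover have "R p -` (h ` B) = h ` p ` B"
    proof -
      have "R p x \<in> h ` B \<longleftrightarrow> x \<in> h ` p ` B" for x
      proof -
        have "R p x \<in> h ` B \<longleftrightarrow> inv_into UNIV p (g x) \<in> B"
          unfolding R_def using inj inv_N[OF p g(1)] B by (simp add: inj_on_image_mem_iff)
        also have "\<dots> \<longleftrightarrow> g x \<in> p ` B"
          using permutes_inverses[OF p] by (metis image_iff)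
        also have "\<dots> \<longleftrightarrow> h (g x) \<in> h ` p ` B"
          by (rule inj_on_image_mem_iff[OF inj g(1) pB, symmetric])
        finally show ?thesis using g(2) by simp
      qed
      then show ?thesis by auto
    qed
    moreover have "h ` (A - p ` B) = h ` A - h ` p ` B" "h ` (p ` B - A) = h ` p ` B - h ` A"
      using A pB by (auto intro!: inj_on_image_set_diff[OF inj])
    then have "h ` sym_diff A (p ` B) = sym_diff (h ` A) (h ` p ` B)"
      by (simp only: image_Un)
    ultimately show ?thesis
      unfolding mult \<Phi>_def by (intro ext) (simp only: prod.case o_apply signed_perm_comp)
  qed
  have R_inj: "p = p'" if p: "p permutes N" and p': "p' permutes N" and eq: "R p = R p'" for p p'
  proof -
    have "inv_into UNIV p a = inv_into UNIV p' a" for a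
    proof (cases "a \<in> N")
      case True
      have "h (inv_into UNIV p a) = h (inv_into UNIV p' a)"
        using fun_cong[OF eq, of "h a"] gh[OF True] by (simp add: R_def)
      then show ?thesis using inj inv_N[OF p True] inv_N[OF p' True] by (simp add: inj_on_eq_iff)
    next
      case False
      then show ?thesis using permutes_inv[OF p] permutes_inv[OF p'] by (simp add: permutes_not_in)
    qed
    then have "inv_into UNIV p = inv_into UNIV p'" by (rule ext)
    then show ?thesis using permutes_inv_inv[OF p] permutes_inv_inv[OF p'] by metis
  qed
  have \<Phi>_inj: "inj_on \<Phi> (carrier ?H)"
    unfolding carrier
    by (rule inj_onI) (auto simp: \<Phi>_def signed_perm_eq_iff inj_on_image_eq_iff[OF inj] R_inj)
  have "\<Phi> ` carrier ?H = carrier ?G"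
  proof
    show "\<Phi> ` carrier ?H \<subseteq> carrier ?G"
      unfolding carrier using even bijR by (auto simp: \<Phi>_def intro!: signed_perm_isometry)
    show "carrier ?G \<subseteq> \<Phi> ` carrier ?H"
    proof
      fix f assume "f \<in> carrier ?G"
      then obtain A r where A: "even (card A)" and r: "bij r" and f: "f = signed_perm A r"
        using P_isometries_eq[OF n] by blast
      \<comment> \<open>Solves \<open>R p = r\<close>; the identity outside \<open>N\<close> is what
        \<open>permutes\<close> demands.\<close>
      define p where "p a = (if a \<in> N then g (inv_into UNIV r (h a)) else a)" for a
      have p: "p permutes N"
      proof (rule bij_imp_permutes)
        show "bij_betw p N N"
        proof (rule bij_betwI[where g = "\<lambda>a. g (r (h a))"])
          fix a assume a: "a \<in> N"
          show "g (r (h (p a))) = a"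
            using a g gh r by (simp add: p_def surj_f_inv_f bij_is_surj)
          show "p (g (r (h a))) = a"
            using a g gh r by (simp add: p_def inv_f_f bij_is_inj)
        qed (use g in \<open>auto simp: p_def\<close>)
      qed (simp add: p_def)
      have "R p = r"
      proof
        fix x
        have "inv_into UNIV p (g x) = g (r x)"
        proof -
          have "p (g (r x)) = g x" using g r by (simp add: p_def inv_f_f bij_is_inj)
          then show ?thesis using permutes_inverses(2)[OF p] by metis
        qed
        then show "R p x = r x" by (simp add: R_def g)
      qed
      moreover have "h ` g ` A = A" using g(2) by (auto simp: image_iff)
      moreover have "card (g ` A) = card A"
        by (rule card_image) (metis inj_onI g(2))
      moreover have "g ` A \<subseteq> N" using g(1) by blast
      ultimately have "(g ` A, p) \<in> carrier ?H" "\<Phi> (g ` A, p) = f"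
        unfolding carrier using A p by (simp_all add: \<Phi>_def f)
      then show "f \<in> \<Phi> ` carrier ?H" by blast
    qed
  qed
  then have bij: "bij_betw \<Phi> (carrier ?H) (carrier ?G)"
    using \<Phi>_inj by (simp only: bij_betw_def)
  moreover have "\<Phi> (a \<otimes>\<^bsub>?H\<^esub> b) = \<Phi> a \<otimes>\<^bsub>?G\<^esub> \<Phi> b" if "a \<in> carrier ?H" "b \<in> carrier ?H" for a b
  proof -
    obtain A p B p' where ab: "a = (A, p)" "b = (B, p')" by (metis surj_pair)
    have "\<Phi> (a \<otimes>\<^bsub>?H\<^esub> b) = \<Phi> a \<circ> \<Phi> b"
      using that unfolding ab carrier by (intro \<Phi>_hom) auto
    then show ?thesis by (simp add: isometry_group_def)
  qed
  ultimately have "\<Phi> \<in> iso ?H ?G"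
    unfolding iso_def hom_def using bij_betwE[OF bij] by blast
  moreover have "a \<otimes>\<^bsub>?H\<^esub> b \<in> carrier ?H" if "a \<in> carrier ?H" "b \<in> carrier ?H" for a b
  proof -
    obtain A p B p' where ab: "a = (A, p)" "b = (B, p')" by (metis surj_pair)
    have A: "A \<subseteq> N" "even (card A)" "p permutes N" and B: "B \<subseteq> N" "even (card B)" "p' permutes N"
      using that unfolding ab carrier by auto
    have "p ` B \<subseteq> N" using A(3) B(1) permutes_image by blast
    moreover have "card (p ` B) = card B" using A(3) by (meson card_image permutes_inj_on)
    moreover have "finite A" "finite (p ` B)"
      using A(1) \<open>p ` B \<subseteq> N\<close> N(1) by (meson finite_subset)+
    ultimately show ?thesis
      using A B permutes_compose[OF B(3) A(3)] unfolding ab mult carrier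
      by (auto simp: even_card_sym_diff)
  qed
  ultimately show ?thesis by (rule is_iso_if_iso_from)
qed

end

section \<open>The isometry group for \<open>n = 6\<close>\<close>

text \<open>The reflection in the hyperplane through the center orthogonal to a vector of squared
  norm 2; that normalization removes the usual denominator.\<close>

definition P_reflection :: "nat \<Rightarrow> (real^'m) \<times> real \<Rightarrow> (real^'m) \<times> real \<Rightarrow> (real^'m) \<times> real" where
  "P_reflection n \<alpha> v = v - P_inner n (v - P_center n) \<alpha> *\<^sub>R \<alpha>"

context P_setting
begin

lemma P_reflection_involution:
  fixes \<alpha> :: "(real^'m) \<times> real"
  assumes "P_form n \<alpha> = 2"
  shows "P_reflection n \<alpha> (P_reflection n \<alpha> v) = v"
proof -
  define k where "k = P_inner n (v - P_center n) \<alpha>"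
  have e: "v - k *\<^sub>R \<alpha> - P_center n = (v - P_center n) - k *\<^sub>R \<alpha>" by simp
  have "P_inner n (v - k *\<^sub>R \<alpha> - P_center n) \<alpha> = - k"
    using assms unfolding e by (simp add: bilinear_simps diag k_def)
  then show ?thesis by (simp add: P_reflection_def k_def)
qed

lemma P_reflection_isometry:
  fixes \<alpha> :: "(real^'m) \<times> real"
  assumes \<alpha>: "P_form n \<alpha> = 2" and vertices: "\<And>v. v \<in> P_vertices \<Longrightarrow> P_reflection n \<alpha> v \<in> P_vertices"
  shows "P_reflection n \<alpha> \<in> P_isometries"
  unfolding P_isometries_iff isometry_between_def
proof (intro conjI allI)
  show "bij (P_reflection n \<alpha>)"
    by (intro o_bij[where g = "P_reflection n \<alpha>"]) (simp_all add: fun_eq_iff P_reflection_involution[OF \<alpha>])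
  show "P_reflection n \<alpha> ` P_vertices = P_vertices"
  proof (intro equalityI subsetI)
    fix v :: "(real^'m) \<times> real" assume "v \<in> P_vertices"
    then show "v \<in> P_reflection n \<alpha> ` P_vertices"
      using vertices P_reflection_involution[OF \<alpha>] by (metis image_eqI)
  qed (use vertices in blast)
  fix x y :: "(real^'m) \<times> real"
  define k where "k = P_inner n (x - y) \<alpha>"
  have "P_inner n (x - P_center n) \<alpha> - P_inner n (y - P_center n) \<alpha> = k"
    by (simp add: k_def bilinear_simps)
  then have "P_reflection n \<alpha> x - P_reflection n \<alpha> y = (x - y) - k *\<^sub>R \<alpha>"
    unfolding P_reflection_def by (simp add: algebra_simps flip: scaleR_diff_left)
  then show "qnorm (P_form n) (P_reflection n \<alpha> x - P_reflection n \<alpha> y) = qnorm (P_form n) (x - y)"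
    using \<alpha> by (simp add: qnorm_eq_iff form_diff[of "x - y"] form_scaleR bilinear_simps(6) k_def power2_eq_square)
qed

lemma P_inner_diff_center:
  fixes v :: "(real^'m) \<times> real"
  shows "P_inner n (v - P_center n) w
    = (\<Sum>i\<in>UNIV. (fst v $ i - 1/2) * fst w $ i) + ((real n - 3) * snd v + 1) / 4 * snd w"
proof -
  have "(N / 4 * ((t - - 1 / N) * u)) = (N * t + 1) / 4 * u" if "N > 0" for N t u :: real
    using that by (simp add: field_simps)
  then show ?thesis
    using real_n by (simp add: P_inner_def P_center_def half_vec_def)
qed

lemma P_inner_diff_center_unit_vec:
  "P_inner n (v - P_center n) (unit_vec i :: (real^'m) \<times> real) = fst v $ i - 1/2"
  by (simp add: P_inner_diff_center axis_def if_distrib[of "\<lambda>x. _ * x"] cong: if_cong)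

lemma P_reflection_transpose:
  assumes "i \<noteq> j"
  shows "P_reflection n (unit_vec i - unit_vec j :: (real^'m) \<times> real) = signed_perm {} (Transposition.transpose i j)"
proof
  fix v :: "(real^'m) \<times> real"
  have "P_inner n (v - P_center n) (unit_vec i - unit_vec j) = fst v $ i - fst v $ j"
    unfolding bilinear_simps(4) P_inner_diff_center_unit_vec by simp
  then show "P_reflection n (unit_vec i - unit_vec j) v = signed_perm {} (Transposition.transpose i j) v"
    using assms by (auto simp: P_reflection_def signed_perm_def prod_eq_iff vec_eq_iff axis_def Transposition.transpose_def)
qed

lemma P_reflection_flip:
  assumes "i \<noteq> j"
  shows "P_reflection n (- unit_vec i - unit_vec j :: (real^'m) \<times> real) = signed_perm {i, j} (Transposition.transpose i j)"
proof
  fix v :: "(real^'m) \<times> real"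
  have "P_inner n (v - P_center n) (- unit_vec i - unit_vec j) = 1 - fst v $ i - fst v $ j"
    unfolding bilinear_simps(4) bilinear_simps(8) P_inner_diff_center_unit_vec by simp
  then show "P_reflection n (- unit_vec i - unit_vec j) v = signed_perm {i, j} (Transposition.transpose i j) v"
    using assms by (auto simp: P_reflection_def signed_perm_def prod_eq_iff vec_eq_iff axis_def Transposition.transpose_def)
qed

end

section \<open>The reflection in the apex and the order of the group\<close>

locale P6_setting = P_setting 6 type for type :: "'m::finite itself"
begin

lemma card_5: "CARD('m) = 5"
  using card_index by simp

lemma P_form_apex: "P_form 6 apex = 2"
  using card_5 by (simp add: P_form_def half_vec_def power2_eq_square)

lemma P_inner_apex:
  fixes v :: "(real^'m) \<times> real"
  shows "P_inner 6 (v - P_center 6) apex = (\<Sum>i\<in>UNIV. fst v $ i) / 2 - 1 + 3 / 4 * snd v"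
  unfolding P_inner_diff_center using card_5
  by (simp add: half_vec_def sum_subtractf sum_divide_distrib[symmetric] field_simps flip: sum_distrib_left)

lemma sum_cube_point: "(\<Sum>i\<in>UNIV. fst (cube_point A :: (real^'m) \<times> real) $ i) = real (card A)"
  by (simp add: cube_point_def sum.If_cases of_bool_def)

lemma apex_reflection_apex: "P_reflection 6 apex apex = cube_point {}"
  unfolding P_reflection_def P_inner_apex cube_point_simps(1)
  using card_5 by (simp add: half_vec_def)

lemma apex_reflection_cube_point:
  "P_reflection 6 apex (cube_point A) = cube_point A - (real (card A) / 2 - 1) *\<^sub>R apex"
  unfolding P_reflection_def P_inner_apex sum_cube_point by (simp add: cube_point_def)

lemma card_Compl_singleton: "card (- {j :: 'm}) = 4"
  using card_5 by (simp add: Compl_eq_Diff_UNIV card_Diff_singleton)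

lemma cube_point_Compl: "cube_point (- {j}) = 2 *\<^sub>R half_point - unit_vec j"
  by (auto simp: cube_point_def vec_eq_iff half_vec_def axis_def)

lemma apex_reflection_cube_point_Compl:
  "P_reflection 6 apex (cube_point (- {j})) = half_point - (0, 1) + (- 1) *\<^sub>R unit_vec j"
proof -
  have "card (- {j}) = 4" by (simp add: card_Compl_singleton)
  then show ?thesis
    unfolding apex_reflection_cube_point unfolding cube_point_Compl
    by (simp add: scaleR_2)
qed

lemma apex_reflection_layer_c:
  assumes "s \<in> {1, - 1}"
  shows "P_reflection 6 apex (half_point - (0, 1) + s *\<^sub>R unit_vec j)
    = (if s = 1 then half_point - (0, 1) + s *\<^sub>R unit_vec j else cube_point (- {j}))"
proof -
  have "(\<Sum>i\<in>UNIV. fst (half_point - (0, 1) + s *\<^sub>R unit_vec j :: (real^'m) \<times> real) $ i) = 5 / 2 + s"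
    using card_5 by (simp add: half_vec_def sum.distrib axis_def if_distrib[of "\<lambda>x. _ * x"] cong: if_cong)
  then have k: "P_inner 6 (half_point - (0, 1) + s *\<^sub>R unit_vec j - P_center 6) apex = (s - 1) / 2"
    unfolding P_inner_apex by (simp add: field_simps)
  show ?thesis
    using assms unfolding P_reflection_def k cube_point_Compl by (auto simp: scaleR_2)
qed

text \<open>Six pairs of vertices are exchanged: the apex with 0, and each cube point of weight 4
  with the vertex of layer -1 of negative sign at the missing index. The other fifteen are fixed. In
  terms of the 27 lines on a cubic surface the pairs form a double-six.\<close>

lemma apex_reflection_P_vertices:
  assumes "v \<in> P_vertices"
  shows "P_reflection 6 apex v \<in> P_vertices"
proof -
  consider "v \<in> layer_a" | "v \<in> layer_b" | "v \<in> layer_c"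
    using assms unfolding P_vertices_def by blast
  then show ?thesis
  proof cases
    case 1
    then have "v = apex" unfolding layer_a_eq by blast
    then have "P_reflection 6 apex v = 0" using apex_reflection_apex cube_point_simps(1) by simp
    then show ?thesis using zero_in_P_vertices by metis
  next
    case 2
    then obtain A where v: "v = cube_point A" and A: "even (card A)" unfolding layer_b_eq by blast
    have "card A \<le> 5" using card_mono[of UNIV A] card_5 by simp
    with A have "card A = 0 \<or> card A = 2 \<or> card A = 4" by presburger
    then consider "A = {}" | "card A = 2" | "card A = 4" by auto
    then show ?thesis
    proof cases
      case 1
      then have "P_reflection 6 apex v = apex"
        unfolding v apex_reflection_cube_point by (simp add: cube_point_simps(1))
      then show ?thesis using apex_in_P_vertices by metis
    next
      case 2
      then have "P_reflection 6 apex v = v"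
        unfolding v apex_reflection_cube_point by (simp flip: zero_prod_def)
      then show ?thesis using assms by simp
    next
      case 3
      then have "card (- A) = 1" using card_5 by (simp add: Compl_eq_Diff_UNIV card_Diff_subset)
      then obtain j where "- A = {j}" by (auto simp: card_1_singleton_iff)
      then have "A = - {j}" by auto
      then show ?thesis
        unfolding v apex_reflection_cube_point_Compl[of j, folded \<open>A = - {j}\<close>] P_vertices_def layer_c_eq by blast
    qed
  next
    case 3
    then obtain s j where s: "s \<in> {1, - 1}" and v: "v = half_point - (0, 1) + s *\<^sub>R unit_vec j"
      unfolding layer_c_eq by blast
    have "even (card (- {j}))" by (simp add: card_Compl_singleton)
    then have "cube_point (- {j}) \<in> P_vertices" unfolding P_vertices_def layer_b_eq by blast
    then show ?thesis using assms unfolding v apex_reflection_layer_c[OF s] by auto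
  qed
qed

text \<open>The reflection sends the apex to 0 and a weight-4 cube point to layer -1; signed
  permutations then fill each of these layers. It serves both the transitivity of the isometry group
  and the identification of the weight orbit.\<close>

lemma P_vertices_subset_if_closed:
  fixes X :: "((real^'m) \<times> real) set"
  assumes apex: "apex \<in> X" and refl: "\<And>v. v \<in> X \<Longrightarrow> P_reflection 6 apex v \<in> X"
    and perm: "\<And>A r v. even (card A) \<Longrightarrow> bij r \<Longrightarrow> v \<in> X \<Longrightarrow> signed_perm A r v \<in> X"
  shows "P_vertices \<subseteq> X"
proof -
  have "cube_point {} \<in> X" using refl[OF apex] unfolding apex_reflection_apex .
  moreover have "cube_point {} \<in> layer_b" unfolding layer_b_eq by fastforce
  ultimately have b: "layer_b \<subseteq> X" using layer_b_transitive perm bij_id by (metis subsetI)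
  obtain j :: 'm where True by simp
  let ?v = "half_point - (0, 1) + (- 1) *\<^sub>R unit_vec j"
  have "even (card (- {j}))" by (simp add: card_Compl_singleton)
  then have "cube_point (- {j}) \<in> X" using b unfolding layer_b_eq by blast
  then have "?v \<in> X" using refl unfolding apex_reflection_cube_point_Compl[symmetric] by blast
  moreover have "?v \<in> layer_c" unfolding layer_c_eq by blast
  moreover have "CARD('m) \<ge> 2" using card_5 by simp
  ultimately have c: "layer_c \<subseteq> X" using layer_c_transitive perm by (metis subsetI)
  have "layer_a \<subseteq> X" using apex unfolding layer_a_eq by blast
  then show ?thesis using b c unfolding P_vertices_def by blast
qed

lemma P_isometries_apex_transitive:
  assumes "v \<in> P_vertices"
  obtains g where "g \<in> P_isometries" "g apex = v"
proof -
  let ?X = "{g apex | g. g \<in> P_isometries}"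
  have closed: "g v \<in> ?X" if g: "g \<in> P_isometries" and v: "v \<in> ?X" for g v
  proof -
    obtain h where "h \<in> P_isometries" "v = h apex" using v by blast
    then have "g \<circ> h \<in> P_isometries" "g v = (g \<circ> h) apex" using isometry_group_comp[OF g] by auto
    then show ?thesis by blast
  qed
  have "P_vertices \<subseteq> ?X"
  proof (rule P_vertices_subset_if_closed)
    have "id \<in> P_isometries" unfolding isometry_group_def isometry_between_def by simp
    then have "id apex \<in> ?X" by blast
    then show "apex \<in> ?X" by (simp only: id_apply)
    show "P_reflection 6 apex v \<in> ?X" if "v \<in> ?X" for v
      using closed[OF P_reflection_isometry[OF P_form_apex apex_reflection_P_vertices] that] .
    show "signed_perm A r v \<in> ?X" if "even (card A)" "bij r" "v \<in> ?X" for A r v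
      using closed[OF signed_perm_isometry[OF that(2,1)] that(3)] .
  qed
  then show ?thesis using assms that by blast
qed

lemma P_isometries_transitive:
  assumes "v \<in> P_vertices" "w \<in> P_vertices"
  shows "\<exists>g\<in>P_isometries. g v = w"
proof -
  obtain g h where g: "g \<in> P_isometries" "g apex = v" and h: "h \<in> P_isometries" "h apex = w"
    using P_isometries_apex_transitive assms by metis
  have "bij g" using g(1) unfolding isometry_group_def isometry_between_def by simp
  then have "inv_into UNIV g v = apex" using g(2) by (metis bij_inv_eq_iff)
  then have "(h \<circ> inv_into UNIV g) v = w" using h by simp
  then show ?thesis using isometry_group_comp[OF h(1) isometry_group_inv[OF g(1)]] by blast
qed

lemma card_P_vertices: "card (P_vertices :: ((real^'m) \<times> real) set) = 27"
proof -
  have "inj_on cube_point {A :: 'm set. A \<subseteq> UNIV \<and> even (card A)}"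
    by (auto simp: inj_on_def cube_point_eq_iff)
  moreover have "(layer_b :: ((real^'m) \<times> real) set) = cube_point ` {A :: 'm set. A \<subseteq> UNIV \<and> even (card A)}"
    unfolding layer_b_eq by auto
  ultimately have "card (layer_b :: ((real^'m) \<times> real) set) = card {A :: 'm set. A \<subseteq> UNIV \<and> even (card A)}"
    using card_image by metis
  then have b: "card (layer_b :: ((real^'m) \<times> real) set) = 16"
    using card_even_subsets[of "UNIV :: 'm set"] card_5 by simp
  let ?f = "\<lambda>(s, j). half_point - (0, 1) + s *\<^sub>R unit_vec j :: (real^'m) \<times> real"
  have "layer_c = ?f ` ({1, - 1} \<times> UNIV)" unfolding layer_c_eq by auto
  moreover have "inj_on ?f ({1, - 1} \<times> UNIV)"
  proof (rule inj_onI)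
    fix x y assume x: "x \<in> {1, - 1} \<times> (UNIV :: 'm set)" and y: "y \<in> {1, - 1 :: real} \<times> (UNIV :: 'm set)"
      and eq: "?f x = ?f y"
    have "snd x = snd y \<and> fst x = fst y"
    proof -
      have "\<forall>i. fst x * axis (snd x) 1 $ i = fst y * axis (snd y) 1 $ i"
        using eq by (auto simp: vec_eq_iff split_def)
      then have "fst x * axis (snd x) 1 $ snd x = fst y * axis (snd y) 1 $ snd x" ..
      then show ?thesis using x y by (auto simp: axis_def split: if_splits)
    qed
    then show "x = y" by (simp add: prod_eq_iff)
  qed
  ultimately have "card (layer_c :: ((real^'m) \<times> real) set) = card ({1, - 1 :: real} \<times> (UNIV :: 'm set))"
    using card_image by metis
  then have c: "card (layer_c :: ((real^'m) \<times> real) set) = 10" using card_5 by (simp add: card_cartesian_product)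
  have fin: "finite (layer_b :: ((real^'m) \<times> real) set)" "finite (layer_c :: ((real^'m) \<times> real) set)"
    using b c by (auto intro: card_ge_0_finite)
  have "layer_a \<inter> (layer_b :: ((real^'m) \<times> real) set) = {}"
    "(layer_a \<union> layer_b) \<inter> (layer_c :: ((real^'m) \<times> real) set) = {}"
    using layer_snd by fastforce+
  then show ?thesis
    using fin b c unfolding P_vertices_def by (simp add: card_Un_disjoint layer_a_def)
qed

text \<open>Sixteen even sets of sign changes times 5! permutations: the order of the Weyl group of
  type D5.\<close>

lemma card_apex_stabilizer: "card {f \<in> P_isometries. f apex = apex} = 1920"
proof -
  let ?S = "{A. A \<subseteq> (UNIV :: 'm set) \<and> even (card A)} \<times> {r :: 'm \<Rightarrow> 'm. r permutes UNIV}"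
  let ?f = "\<lambda>(A, r). signed_perm A r :: (real^'m) \<times> real \<Rightarrow> (real^'m) \<times> real"
  have "bij r \<longleftrightarrow> r permutes UNIV" for r :: "'m \<Rightarrow> 'm"
    using bij_imp_permutes[of r UNIV] permutes_bij by auto
  then have "{f \<in> P_isometries. f apex = apex} = ?f ` ?S"
    unfolding apex_stabilizer_eq by auto
  moreover have "inj_on ?f ?S" by (auto simp: inj_on_def signed_perm_eq_iff)
  ultimately have "card {f \<in> P_isometries. f apex = apex} = card ?S" by (simp only: card_image)
  also have "\<dots> = 16 * fact 5"
    using card_even_subsets[of "UNIV :: 'm set"] card_permutations[of "UNIV :: 'm set" 5] card_5
    by (simp add: card_cartesian_product)
  finally show ?thesis by (simp add: fact_numeral)
qed

text \<open>Orbit-stabilizer with explicit representatives: \<open>t v\<close> carries the apex to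
  \<open>v\<close>, and every isometry is uniquely \<open>t v\<close> after an element of the
  stabilizer.\<close>

lemma card_P_isometries: "card P_isometries = 51840"
proof -
  have "\<forall>v\<in>P_vertices. \<exists>g. g \<in> P_isometries \<and> g apex = v"
    using P_isometries_apex_transitive by blast
  then obtain t where t: "\<And>v. v \<in> P_vertices \<Longrightarrow> t v \<in> P_isometries" "\<And>v. v \<in> P_vertices \<Longrightarrow> t v apex = v"
    by metis
  let ?S = "{f \<in> P_isometries. f apex = apex}"
  have bij: "bij f" if "f \<in> P_isometries" for f
    using that unfolding isometry_group_def isometry_between_def by simp
  have "inj_on (\<lambda>(v, g). t v \<circ> g) (P_vertices \<times> ?S)"
  proof (rule inj_onI, clarify)
    fix v g w h
    assume v: "v \<in> P_vertices" and w: "w \<in> P_vertices" and g: "g apex = apex" and h: "h apex = apex"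
      and eq: "t v \<circ> g = t w \<circ> h"
    have vw: "v = w" using fun_cong[OF eq, of apex] g h t(2) v w by (simp only: o_apply)
    have "g x = h x" for x
      using fun_cong[OF eq, of x] bij[OF t(1)[OF w]] unfolding vw by (simp add: bij_def inj_eq)
    then show "v = w \<and> g = h" using vw ext by blast
  qed
  moreover have "(\<lambda>(v, g). t v \<circ> g) ` (P_vertices \<times> ?S) = P_isometries"
  proof (intro equalityI image_subsetI subsetI)
    fix x assume "x \<in> (P_vertices :: ((real^'m) \<times> real) set) \<times> ?S"
    then show "(case x of (v, g) \<Rightarrow> t v \<circ> g) \<in> P_isometries"
      by (cases x) (simp add: isometry_group_comp[OF t(1)])
  next
    fix f assume f: "f \<in> P_isometries"
    let ?v = "f apex"
    have v: "?v \<in> P_vertices" using P_isometries_vertex[OF f apex_in_P_vertices] .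
    let ?g = "inv_into UNIV (t ?v) \<circ> f"
    have "?g \<in> P_isometries" using isometry_group_comp[OF isometry_group_inv[OF t(1)[OF v]] f] .
    moreover have "?g apex = apex"
      using t(2)[OF v] bij[OF t(1)[OF v]] unfolding o_apply by (metis bij_inv_eq_iff)
    ultimately have S: "(?v, ?g) \<in> P_vertices \<times> ?S" using v by blast
    have "t ?v \<circ> ?g = f"
      using bij[OF t(1)[OF v]] by (simp add: fun_eq_iff surj_f_inv_f bij_is_surj)
    then have "f = (\<lambda>(v, g). t v \<circ> g) (?v, ?g)" by (simp only: prod.case)
    then show "f \<in> (\<lambda>(v, g). t v \<circ> g) ` (P_vertices \<times> ?S)" using S by (rule image_eqI)
  qed
  ultimately have "card P_isometries = card ((P_vertices :: ((real^'m) \<times> real) set) \<times> ?S)"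
    using card_image[of "\<lambda>(v, g). t v \<circ> g" "P_vertices \<times> ?S"] by argo
  then show ?thesis
    unfolding card_cartesian_product card_P_vertices card_apex_stabilizer by simp
qed

end

section \<open>The Schlaefli polytope\<close>

lemma exhaust_6: "x = 1 \<or> x = 2 \<or> x = 3 \<or> x = 4 \<or> x = 5 \<or> x = 6" for x :: 6
proof (induct x)
  case (of_int z)
  then have "z = 0 \<or> z = 1 \<or> z = 2 \<or> z = 3 \<or> z = 4 \<or> z = 5" by fastforce
  then show ?case by auto
qed

lemma forall_6: "(\<forall>i::6. P i) \<longleftrightarrow> P 1 \<and> P 2 \<and> P 3 \<and> P 4 \<and> P 5 \<and> P 6"
  by (metis exhaust_6)

lemma sum_6: "sum f (UNIV :: 6 set) = f 1 + f 2 + f 3 + f 4 + f 5 + f 6"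
proof -
  have UNIV: "(UNIV :: 6 set) = {1, 2, 3, 4, 5, 6}" using exhaust_6 by auto
  show ?thesis unfolding UNIV by (simp add: add.assoc)
qed

lemma E6_inner_expand:
  "E6_inner x y = 2 * (x$1 * y$1 + x$2 * y$2 + x$3 * y$3 + x$4 * y$4 + x$5 * y$5 + x$6 * y$6)
    - (x$1 * y$2 + x$2 * y$1) - (x$2 * y$3 + x$3 * y$2) - (x$3 * y$4 + x$4 * y$3)
    - (x$4 * y$5 + x$5 * y$4) - (x$3 * y$6 + x$6 * y$3)"
  unfolding E6_inner_def sum_6 by simp

text \<open>Naming the five indices lets sums over the index type be expanded and the Dynkin diagram
  be written down.\<close>

locale E6_setting = P6_setting type for type :: "'m::finite itself" +
  fixes k1 k2 k3 k4 k5 :: 'm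
  assumes distinct_indices: "distinct [k1, k2, k3, k4, k5]"
begin

lemma UNIV_indices: "(UNIV :: 'm set) = {k1, k2, k3, k4, k5}"
proof -
  have "card {k1, k2, k3, k4, k5} = 5" using distinct_indices by simp
  then show ?thesis using card_5 by (metis card_subset_eq finite subset_UNIV)
qed

lemma sum_indices: "sum f (UNIV :: 'm set) = f k1 + f k2 + f k3 + f k4 + f k5"
  unfolding UNIV_indices using distinct_indices by (simp add: ac_simps)

text \<open>Simple roots of \<open>E\<^sub>6\<close> inside \<open>L\<^sub>6\<close>. All of them except the first are orthogonal to the
  difference of the apex and the center, so this difference is the fundamental weight of node 1.\<close>

definition simple_root :: "6 \<Rightarrow> (real^'m) \<times> real" where
  "simple_root i =
     (if i = 1 then apex
      else if i = 2 then - unit_vec k4 - unit_vec k5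
      else if i = 3 then unit_vec k4 - unit_vec k3
      else if i = 4 then unit_vec k3 - unit_vec k2
      else if i = 5 then unit_vec k2 - unit_vec k1
      else unit_vec k5 - unit_vec k4)"

section \<open>Embedding of the root coordinates\<close>

definition root_map :: "real^6 \<Rightarrow> (real^'m) \<times> real" where
  "root_map x = (\<Sum>i\<in>UNIV. x $ i *\<^sub>R simple_root i)"

lemma linear_root_map: "linear root_map"
  unfolding root_map_def by (rule linearI) (simp_all add: scaleR_add_left sum.distrib scaleR_sum_right)

lemma root_map_axis: "root_map (axis i 1) = simple_root i"
  unfolding root_map_def axis_def by (simp add: if_distrib[of "\<lambda>x. x *\<^sub>R _"] cong: if_cong)

lemma root_map_components:
  "snd (root_map x) = x$1"
  "fst (root_map x) $ k1 = x$1 / 2 - x$5"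
  "fst (root_map x) $ k2 = x$1 / 2 + x$5 - x$4"
  "fst (root_map x) $ k3 = x$1 / 2 + x$4 - x$3"
  "fst (root_map x) $ k4 = x$1 / 2 + x$3 - x$2 - x$6"
  "fst (root_map x) $ k5 = x$1 / 2 - x$2 + x$6"
  unfolding root_map_def sum_6 using distinct_indices
  by (auto simp: simple_root_def half_vec_def axis_def)

text \<open>Both sides agree as polynomials in the coordinates, which verifies that the chosen roots
  realize the Dynkin diagram with the prescribed labelling.\<close>

lemma P_inner_root_map: "P_inner 6 (root_map x) (root_map y) = E6_inner x y"
  unfolding P_inner_def sum_indices root_map_components E6_inner_expand
  by (simp add: field_simps)

lemma P_form_root_map: "P_form 6 (root_map x) = E6_form x"
  unfolding diag P_inner_root_map E6_form_def ..

lemma bij_root_map: "bij root_map"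
proof -
  have inj: "inj root_map"
  proof (rule linear_injective_0[THEN iffD2, OF linear_root_map], intro allI impI)
    fix x assume "root_map x = 0"
    then have z: "snd (root_map x) = 0" "fst (root_map x) $ i = 0" for i by simp_all
    have "x$1 = 0" "x$1 / 2 - x$5 = 0" "x$1 / 2 + x$5 - x$4 = 0" "x$1 / 2 + x$4 - x$3 = 0"
      "x$1 / 2 + x$3 - x$2 - x$6 = 0" "x$1 / 2 - x$2 + x$6 = 0"
      using z(1) z(2)[of k1] z(2)[of k2] z(2)[of k3] z(2)[of k4] z(2)[of k5]
      unfolding root_map_components by blast+
    then show "x = 0" by (simp add: vec_eq_iff forall_6)
  qed
  have "dim (range root_map) = DIM((real^'m) \<times> real)"
    using dim_image_eq[OF linear_root_map, of UNIV] inj card_5 by simp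
  then have "span (range root_map) = UNIV" by (simp only: dim_eq_full)
  moreover have "span (range root_map) = range root_map"
    using linear_span_image[OF linear_root_map, of UNIV] by simp
  ultimately show ?thesis using inj by (simp add: bij_def)
qed

text \<open>The origin goes to the center of the sphere, so that linear reflections become
  reflections through the center.\<close>

definition E6_to_P :: "real^6 \<Rightarrow> (real^'m) \<times> real" where
  "E6_to_P x = root_map x + P_center 6"

lemma bij_E6_to_P: "bij E6_to_P"
proof (rule bijI)
  show "inj E6_to_P" using bij_root_map unfolding E6_to_P_def by (auto simp: inj_def bij_def)
  show "surj E6_to_P"
  proof (rule surjI)
    fix v
    have "root_map (inv_into UNIV root_map (v - P_center 6)) = v - P_center 6"
      using bij_root_map by (simp add: surj_f_inv_f bij_is_surj)
    then show "E6_to_P (inv_into UNIV root_map (v - P_center 6)) = v"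
      unfolding E6_to_P_def by simp
  qed
qed

lemma E6_to_P_reflection: "E6_to_P (E6_reflection i x) = P_reflection 6 (simple_root i) (E6_to_P x)"
proof -
  have "E6_to_P x - P_center 6 = root_map x" by (simp add: E6_to_P_def)
  moreover have "P_inner 6 (root_map x) (simple_root i) = E6_inner x (axis i 1)"
    unfolding root_map_axis[symmetric] by (rule P_inner_root_map)
  ultimately show ?thesis
    unfolding E6_reflection_def P_reflection_def
    by (simp add: E6_to_P_def linear_diff[OF linear_root_map] linear_scale[OF linear_root_map] root_map_axis)
qed

lemma simple_root_reflections:
  "P_reflection 6 (simple_root 1) = P_reflection 6 apex"
  "P_reflection 6 (simple_root 2) = signed_perm {k4, k5} (Transposition.transpose k4 k5)"
  "P_reflection 6 (simple_root 3) = signed_perm {} (Transposition.transpose k4 k3)"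
  "P_reflection 6 (simple_root 4) = signed_perm {} (Transposition.transpose k3 k2)"
  "P_reflection 6 (simple_root 5) = signed_perm {} (Transposition.transpose k2 k1)"
  "P_reflection 6 (simple_root 6) = signed_perm {} (Transposition.transpose k5 k4)"
proof -
  have neq: "k4 \<noteq> k3" "k3 \<noteq> k2" "k2 \<noteq> k1" "k5 \<noteq> k4" "k4 \<noteq> k5" using distinct_indices by auto
  then show "P_reflection 6 (simple_root 1) = P_reflection 6 apex"
    "P_reflection 6 (simple_root 2) = signed_perm {k4, k5} (Transposition.transpose k4 k5)"
    "P_reflection 6 (simple_root 3) = signed_perm {} (Transposition.transpose k4 k3)"
    "P_reflection 6 (simple_root 4) = signed_perm {} (Transposition.transpose k3 k2)"
    "P_reflection 6 (simple_root 5) = signed_perm {} (Transposition.transpose k2 k1)"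
    "P_reflection 6 (simple_root 6) = signed_perm {} (Transposition.transpose k5 k4)"
    using P_reflection_transpose[OF neq(1)] P_reflection_transpose[OF neq(2)] P_reflection_transpose[OF neq(3)]
      P_reflection_transpose[OF neq(4)] P_reflection_flip[OF neq(5)]
    by (simp_all add: simple_root_def)
qed

lemma simple_reflection_P_vertices:
  assumes "v \<in> P_vertices"
  shows "P_reflection 6 (simple_root i) v \<in> P_vertices"
proof -
  have perm: "signed_perm A r v \<in> P_vertices" if "bij r" "even (card A)" for A r
    using signed_perm_P_vertices[OF that] assms by blast
  have "even (card {k4, k5})" using distinct_indices by simp
  then show ?thesis
    using exhaust_6[of i] apex_reflection_P_vertices[OF assms]
    by (elim disjE) (simp_all only: simple_root_reflections perm bij_swap card.empty even_zero bij_transpose)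
qed

text \<open>The reflections in the five roots \<open>\<alpha>\<^sub>2, \<dots>, \<alpha>\<^sub>6\<close> generate the stabilizer of the apex, the Weyl group
  of \<open>D\<^sub>5\<close>.\<close>

lemma signed_perm_closed:
  fixes X :: "((real^'m) \<times> real) set"
  assumes closed: "\<And>i v. v \<in> X \<Longrightarrow> P_reflection 6 (simple_root i) v \<in> X"
    and A: "even (card A)" and r: "bij r" and v: "v \<in> X"
  shows "signed_perm A r v \<in> X"
proof -
  \<comment> \<open>The signed permutations that map \<open>X\<close> into itself are closed under
    composition, so it is enough to generate from the simple reflections.\<close>
  define C where "C A r \<longleftrightarrow> (\<forall>v\<in>X. signed_perm A r v \<in> X)" for A r
  have comp: "C (sym_diff A (r -` B)) (s \<circ> r)" if "C A r" "C B s" for A B r s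
    using that unfolding C_def signed_perm_comp[symmetric] by blast
  have refl: "C {k4, k5} (Transposition.transpose k4 k5)" "C {} (Transposition.transpose k4 k3)"
    "C {} (Transposition.transpose k3 k2)" "C {} (Transposition.transpose k2 k1)"
    "C {} (Transposition.transpose k5 k4)"
    using closed unfolding C_def simple_root_reflections[symmetric] by blast+
  have id: "C {} id" unfolding C_def by simp
  \<comment> \<open>Conjugating one transposition by another links the adjacent swaps along the
    chain of indices.\<close>
  have trans: "C {} (Transposition.transpose i l)"
    if ij: "C {} (Transposition.transpose i j)" and jl: "C {} (Transposition.transpose j l)" for i j l
  proof (cases "i = l \<or> j = l")
    case True
    then show ?thesis using ij id by auto
  next
    case False
    then have "Transposition.transpose i l
        = Transposition.transpose i j \<circ> (Transposition.transpose j l \<circ> Transposition.transpose i j)"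
      by (auto simp: fun_eq_iff Transposition.transpose_def)
    then show ?thesis using comp[OF comp[OF ij jl] ij] by simp
  qed
  have base: "C {} (Transposition.transpose k4 j)" for j
  proof -
    have "C {} (Transposition.transpose k4 k3)" by (rule refl)
    moreover from this have "C {} (Transposition.transpose k4 k2)" using refl trans by blast
    moreover from this have "C {} (Transposition.transpose k4 k1)" using refl trans by blast
    moreover have "C {} (Transposition.transpose k4 k5)" using refl(5) by (simp add: transpose_commute)
    moreover have "C {} (Transposition.transpose k4 k4)" using id by simp
    moreover have "j \<in> {k1, k2, k3, k4, k5}" using UNIV_indices by blast
    ultimately show ?thesis by blast
  qed
  have transposes: "C {} (Transposition.transpose i j)" for i j
    using trans[of i k4 j] base[of i] base[of j] by (simp add: transpose_commute)
  have perms: "C {} p" if "bij p" for p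
  proof -
    have "p permutes UNIV" by (rule bij_imp_permutes[OF that]) simp
    then show ?thesis using finite
    proof (induction rule: permutes_induct)
      case id
      show ?case by (rule \<open>C {} id\<close>)
    next
      case (swap a b p)
      then have "C {} p" by blast
      from comp[OF this transposes[of a b]] show ?case by (simp only: vimage_empty Diff_empty Un_empty_left)
    qed
  qed
  \<comment> \<open>The reflection in the second simple root swaps two coordinates and changes both
    signs; undoing the swap isolates the sign changes.\<close>
  have k45: "C {k4, k5} id"
  proof -
    have "C (sym_diff {} (Transposition.transpose k4 k5 -` {k4, k5}))
        (Transposition.transpose k4 k5 \<circ> Transposition.transpose k4 k5)"
      by (rule comp[OF transposes refl(1)])
    moreover have "Transposition.transpose k4 k5 -` {k4, k5} = {k4, k5}"
      by (auto simp: Transposition.transpose_def split: if_splits)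
    ultimately show ?thesis by simp
  qed
  have pairs: "C {i, j} id" if "i \<noteq> j" for i j
  proof -
    \<comment> \<open>A permutation taking \<open>i\<close> to \<open>k4\<close> and
      \<open>j\<close> to \<open>k5\<close>: the first swap places \<open>i\<close>, and the second
      places the displaced \<open>j\<close> without moving \<open>k4\<close>. Conjugating by it
      carries \<open>k45\<close> to any pair.\<close>
    define p where "p = Transposition.transpose (Transposition.transpose i k4 j) k5 \<circ> Transposition.transpose i k4"
    have p: "bij p" by (simp add: p_def bij_comp)
    have "Transposition.transpose i k4 j \<noteq> k4" using that by (auto simp: Transposition.transpose_def split: if_splits)
    then have pi: "p i = k4" "p j = k5"
      using distinct_indices by (auto simp: p_def)
    have inv: "inv_into UNIV p \<circ> p = id" using p by (simp add: bij_is_inj)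
    have "p -` {k4, k5} = {i, j}"
      using p unfolding pi[symmetric] by (auto simp: bij_def inj_eq)
    then have "C (sym_diff {} {i, j}) (id \<circ> p)" using comp[OF perms[OF p] k45] by simp
    then have "C {i, j} p" by simp
    from comp[OF this perms[OF bij_imp_bij_inv[OF p]]] show ?thesis
      by (simp add: inv)
  qed
  have "C A id" using A
  proof (induction "card A" arbitrary: A rule: less_induct)
    case less
    show ?case
    proof (cases "A = {}")
      case False
      then obtain i where i: "i \<in> A" by blast
      have "A \<noteq> {i}" using less.prems by auto
      then obtain j where j: "j \<in> A" "j \<noteq> i" using i by blast
      let ?A = "A - {i, j}"
      have card: "card A = card ?A + 2"
        using i j card_Diff_subset[of "{i, j}" A] card_mono[of A "{i, j}"] by simp
      then have "C ?A id" using less.prems by (intro less.hyps) auto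
      from comp[OF this pairs[of i j]] j have "C (sym_diff ?A {i, j}) id" by simp
      moreover have "sym_diff ?A {i, j} = A" using i j by auto
      ultimately show ?thesis by simp
    qed (use id in simp)
  qed
  then have "C A r" using comp[OF _ perms[OF r], of A id] by simp
  then show ?thesis using v by (simp add: C_def)
qed

definition E6_weights :: "(real^6) set" where
  "E6_weights = {w. \<forall>j. E6_inner w (axis j 1) = (if j = 1 then 1 else 0)}"

lemma apex_weight: "P_inner 6 (apex - P_center 6) (simple_root j) = (if j = 1 then 1 else 0)"
proof -
  have u: "P_inner 6 (apex - P_center 6) (unit_vec i :: (real^'m) \<times> real) = 0" for i
    unfolding P_inner_diff_center_unit_vec by (simp add: half_vec_def)
  have "P_inner 6 (apex - P_center 6 :: (real^'m) \<times> real) apex = 1"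
    unfolding P_inner_apex using card_5 by (simp add: half_vec_def)
  then show ?thesis unfolding simple_root_def
    by (simp add: u bilinear_simps(4) bilinear_simps(8) del: add_Pair diff_Pair uminus_Pair)
qed

text \<open>The simple roots span, so the products with them determine a vector; those of the apex
  seen from the center are the products of the fundamental weight of node 1.\<close>

lemma E6_to_P_weights: "E6_to_P ` E6_weights = {apex}"
proof -
  have iff: "w \<in> E6_weights \<longleftrightarrow> E6_to_P w = apex" for w
  proof
    assume "w \<in> E6_weights"
    then have "P_inner 6 (root_map w) (simple_root j) = P_inner 6 (apex - P_center 6) (simple_root j)" for j
      unfolding apex_weight unfolding root_map_axis[symmetric] P_inner_root_map E6_weights_def by blast
    then have "P_inner 6 (root_map w - (apex - P_center 6)) (simple_root j) = 0" for j
      by (simp only: bilinear_simps(3))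
    moreover have "linear (P_inner 6 (root_map w - (apex - P_center 6)))"
      using bilinear unfolding bilinear_def by blast
    ultimately have "P_inner 6 (root_map w - (apex - P_center 6)) (root_map x) = 0" for x
      unfolding root_map_def[of x] by (simp add: linear_sum linear_scale)
    then have "P_inner 6 (root_map w - (apex - P_center 6)) y = 0" for y
      using bij_root_map by (metis bij_pointE)
    then have "root_map w - (apex - P_center 6) = 0" by (rule eq_0_if_orthogonal)
    then show "E6_to_P w = apex" unfolding E6_to_P_def by (simp add: algebra_simps)
  next
    assume "E6_to_P w = apex"
    then have "root_map w = apex - P_center 6" unfolding E6_to_P_def by (simp add: eq_diff_eq)
    then have "E6_inner w (axis j 1) = (if j = 1 then 1 else 0)" for j
      unfolding P_inner_root_map[symmetric] root_map_axis using apex_weight by metis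
    then show "w \<in> E6_weights" unfolding E6_weights_def by blast
  qed
  obtain w where w: "E6_to_P w = apex" using bij_E6_to_P by (metis bij_pointE)
  show ?thesis
  proof (intro equalityI subsetI)
    fix v assume "v \<in> E6_to_P ` E6_weights"
    then show "v \<in> {apex}" using iff by (metis imageE singletonI)
  next
    fix v assume "v \<in> {apex}"
    then show "v \<in> E6_to_P ` E6_weights" using w iff by (metis imageI singletonD)
  qed
qed

text \<open>The simple reflections preserve the vertex set, which bounds the orbit. Conversely they
  generate the moves of \<open>P_vertices_subset_if_closed\<close>, so the orbit of the apex reaches
  every vertex.\<close>

lemma E6_to_P_orbit: "E6_to_P ` E6_orbit E6_weights = P_vertices"
proof
  have "E6_to_P x \<in> P_vertices" if "x \<in> E6_orbit E6_weights" for x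
    using that
  proof induction
    case (base w)
    then have "E6_to_P w = apex" using E6_to_P_weights by blast
    then show ?case using apex_in_P_vertices by metis
  next
    case (reflect x i)
    then show ?case unfolding E6_to_P_reflection by (intro simple_reflection_P_vertices)
  qed
  then show "E6_to_P ` E6_orbit E6_weights \<subseteq> P_vertices" by blast
  show "P_vertices \<subseteq> E6_to_P ` E6_orbit E6_weights"
  proof (rule P_vertices_subset_if_closed)
    let ?X = "E6_to_P ` E6_orbit E6_weights"
    have closed: "P_reflection 6 (simple_root i) v \<in> ?X" if "v \<in> ?X" for i v
    proof -
      obtain x where x: "x \<in> E6_orbit E6_weights" "v = E6_to_P x" using \<open>v \<in> ?X\<close> by blast
      have "E6_to_P (E6_reflection i x) \<in> ?X" using E6_orbit.reflect[OF x(1)] by blast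
      then show ?thesis unfolding x(2) E6_to_P_reflection .
    qed
    have "E6_weights \<subseteq> E6_orbit E6_weights" by (auto intro: E6_orbit.base)
    then show "apex \<in> ?X" using E6_to_P_weights by blast
    show "P_reflection 6 apex v \<in> ?X" if "v \<in> ?X" for v
      using closed[OF that, of 1] unfolding simple_root_reflections(1) .
    show "signed_perm A r v \<in> ?X" if "even (card A)" "bij r" "v \<in> ?X" for A r v
      by (rule signed_perm_closed[OF closed that])
  qed
qed

lemma schlafli_isometry:
  "\<exists>f. isometry_between (P_form 6) E6_form f \<and> f ` (P_polytope :: ((real^'m) \<times> real) set) = schlafli_polytope"
proof (intro exI conjI)
  let ?f = "inv_into UNIV E6_to_P"
  have "E6_to_P ` schlafli_polytope = convex hull (E6_to_P ` E6_orbit E6_weights)"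
    unfolding schlafli_polytope_def E6_weights_def[symmetric] E6_to_P_def
    by (rule convex_hull_affine_image[OF linear_root_map])
  then have "E6_to_P ` schlafli_polytope = P_polytope"
    unfolding E6_to_P_orbit P_polytope_eq .
  then show "?f ` P_polytope = schlafli_polytope"
    using bij_E6_to_P by (metis bij_is_inj image_inv_f_f)
  have "E6_form (?f x - ?f y) = P_form 6 (x - y)" for x y
  proof -
    have "root_map (?f x - ?f y) = E6_to_P (?f x) - E6_to_P (?f y)"
      unfolding E6_to_P_def linear_diff[OF linear_root_map] by simp
    also have "\<dots> = x - y" using bij_E6_to_P by (simp add: surj_f_inv_f bij_is_surj)
    finally show ?thesis using P_form_root_map by metis
  qed
  then show "isometry_between (P_form 6) E6_form ?f"
    unfolding isometry_between_def qnorm_def using bij_E6_to_P by (simp add: bij_imp_bij_inv)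
qed

end

theorem theorem1:
  fixes n :: nat
    and L P :: "((real^'m) \<times> real) set"
    and q :: "(real^'m) \<times> real \<Rightarrow> real"
  assumes "n \<ge> 6" and "even n" and "CARD('m) = n - 1"
    and "L = L_lattice" and "P = P_polytope" and "q = P_form n"
  shows
    "(extreme_delaunay_polytope q L P \<and>
      (\<forall>q'. delaunay_polytope q' L P \<longleftrightarrow> (\<exists>k>0. q' = (\<lambda>x. k * q x)))) \<and>
     (\<forall>c r. circumscribing_sphere q L P c r \<longleftrightarrow>
        c = (half_vec, - 1 / (real n - 3)) \<and> r = (real n - 2) / (2 * sqrt (real n - 3))) \<and>
     (n = 6 \<longrightarrow>
        (\<exists>f. isometry_between q E6_form f \<and> f ` P = schlafli_polytope) \<and>
        card (carrier (isometry_group q P)) = 51840 \<and>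
        (\<forall>v \<in> polytope_vertices P. \<forall>w \<in> polytope_vertices P.
           \<exists>g \<in> carrier (isometry_group q P). g v = w)) \<and>
     (n > 6 \<longrightarrow>
        isometry_group q P \<cong>
          semidirect_product (even_subset_group (n - 1)) (sym_group (n - 1)) image \<and>
        even_subset_group (n - 1) \<cong> elementary_abelian_2_group (n - 2) \<and>
        card (orbits (isometry_group q P) (polytope_vertices P) (\<lambda>g. g)) = 3)"
proof -
  interpret P_setting n "TYPE('m)"
    using assms(1-3) by unfold_locales
  have center: "(half_vec, - 1 / (real n - 3)) = (P_center n :: (real^'m) \<times> real)"
    by (simp add: P_center_def)
  have sphere: "circumscribing_sphere q L P c r \<longleftrightarrow>
      c = (half_vec, - 1 / (real n - 3)) \<and> r = (real n - 2) / (2 * sqrt (real n - 3))" for c r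
    unfolding assms(4-6) center circumscribing_sphere_P_iff radius_def ..
  have six: "(\<exists>f. isometry_between q E6_form f \<and> f ` P = schlafli_polytope) \<and>
      card (carrier (isometry_group q P)) = 51840 \<and>
      (\<forall>v \<in> polytope_vertices P. \<forall>w \<in> polytope_vertices P.
         \<exists>g \<in> carrier (isometry_group q P). g v = w)" if "n = 6"
  proof -
    interpret six: P6_setting "TYPE('m)"
      using P_setting_axioms that by (simp add: P6_setting_def)
    obtain p i j k l :: 'm where "distinct [p, i, j, k, l]"
      using obtain_distinct_five[OF card_ge] .
    then interpret E6: E6_setting "TYPE('m)" p i j k l
      by unfold_locales
    show ?thesis
      unfolding assms(4-6) that six.polytope_vertices_P
      using E6.schlafli_isometry six.card_P_isometries six.P_isometries_transitive by blast
  qed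
  have large: "isometry_group q P \<cong>
        semidirect_product (even_subset_group (n - 1)) (sym_group (n - 1)) image \<and>
      even_subset_group (n - 1) \<cong> elementary_abelian_2_group (n - 2) \<and>
      card (orbits (isometry_group q P) (polytope_vertices P) (\<lambda>g. g)) = 3" if "n > 6"
  proof -
    have "n - 1 = Suc (n - 2)" using n_ge by simp
    then show ?thesis
      unfolding assms(4-6)
      using isometry_group_iso[OF that] card_orbits[OF that] even_subset_group_iso[of "n - 2"] by simp
  qed
  show ?thesis
    using extreme_delaunay_polytope_P delaunay_polytope_P_iff sphere six large
    unfolding assms(4-6) by blast
qed

end
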